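(* Let $G$ be a nilpotent group (regarded as a discrete semigroup), let $\mathcal{F}$ be the set of all finite subsets of $\mathbb{N}$, and let $\mathcal{R}$ be a system, i.e. a finite set of polynomial mappings $P:\mathcal{F}\to G$. Let $v\in\beta\mathcal{F}$ be an idempotent, $v=v+v$, with respect to the partial semigroup operation $\uplus$ (union of disjoint sets). Let $A$ be a piecewise syndetic subset of $G$ and let $L$ be a minimal left ideal of $\beta G$ such that $\overline{A}\cap L\neq\emptyset$. Then $$\Big\{\alpha\in\mathcal{F}:\ \overline{A}\cap L\cap\bigcap_{P\in\mathcal{R}}\overline{P(\alpha)^{-1}A}\neq\emptyset\Big\}\in v .$$
   Context: For a discrete semigroup $(G,\cdot)$, $\beta G$ is the set of ultrafilters on $G$, with basic (cl)open sets $\overline{A}=\{p\in\beta G: A\in p\}$ for $A\subseteq G$. The operation is extended to $\beta G$ by: $A\in p\cdot q$ iff $\{x\in G: x^{-1}A\in q\}\in p$, where $x^{-1}A=\{y\in G: xy\in A\}$. This makes $\beta G$ a compact right topological semigroup (each map $q\mapsto q\cdot p$ is continuous). A left ideal of $\beta G$ is a nonempty set $I$ with $\beta G\cdot I\subseteq I$; it is minimal if it does not properly contain another left ideal. $K(\beta G)$ is the union of all minimal left ideals. A set $A\subseteq G$ is piecewise syndetic if $\overline{A}\cap K(\beta G)\neq\emptyset$. Partial semigroup: $\mathcal{F}$ is the set of finite subsets of $\mathbb{N}$, with $\alpha\uplus\beta=\alpha\cup\beta$ defined exactly when $\alpha\cap\beta=\emptyset$. The induced operation $+$ is defined on the set of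 ultrafilters $p$ on $\mathcal{F}$ such that $\{\alpha\in\mathcal{F}:\alpha\cap\beta=\emptyset\}\in p$ for every $\beta\in\mathcal{F}$, by: $D\in p+q$ iff $\{\alpha\in\mathcal{F}:\{\beta\in\mathcal{F}:\alpha\cap\beta=\emptyset,\ \alpha\cup\beta\in D\}\in q\}\in p$. The ultrafilter $v$ is an idempotent for this operation. Polynomial mappings: for an integer $d\ge 0$, a monomial of degree $d$ is a pair $(u,\prec)$ with $u:\mathbb{N}^d\to G$ a map and $\prec$ a linear order on $\mathbb{N}^d$; it induces the monomial mapping $P_u:\mathcal{F}\to G$, $P_u(\alpha)=\prod^{\prec}_{s\in\alpha^d}u(s)$, where the factors are multiplied in the order given by $\prec$ (an empty product is $1_G$). A polynomial mapping $P:\mathcal{F}\to G$ is a pointwise product of finitely many monomial mappings, $P(\alpha)=P_{u_1}(\alpha)P_{u_2}(\alpha)\cdots P_{u_m}(\alpha)$.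
   Formalization: The formal theorem also assumes P(∅)=1_G for every P in the system; without this the claim fails, since degree-0 monomials give constant maps (G=Z/2, A={0}, P constantly the nonzero element). Every product of monomials of degree at least 1 satisfies it. *)

theory Defs
  imports "HOL-Algebra.Algebra"
begin

fun lower_central :: "('a, 'b) monoid_scheme \<Rightarrow> nat \<Rightarrow> 'a set" where
  "lower_central G 0 = carrier G"
| "lower_central G (Suc n) =
     generate G {h \<otimes>\<^bsub>G\<^esub> g \<otimes>\<^bsub>G\<^esub> inv\<^bsub>G\<^esub> h \<otimes>\<^bsub>G\<^esub> inv\<^bsub>G\<^esub> g | h g. h \<in> lower_central G n \<and> g \<in> carrier G}"

locale nilpotent_group = group +
  assumes lower_central_trivial: "\<exists>n. lower_central G n = {\<one>}"

text \<open>Ultrafilters live on a carrier set \<open>S\<close> and are represented as the sets of their members,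
  so that membership \<open>A \<in> p\<close> is literal.\<close>

definition ultrafilters :: "'x set \<Rightarrow> 'x set set set" where
  "ultrafilters S = {p. p \<subseteq> Pow S \<and> S \<in> p \<and> {} \<notin> p
     \<and> (\<forall>A\<in>p. \<forall>B\<in>p. A \<inter> B \<in> p)
     \<and> (\<forall>A\<in>p. \<forall>B. A \<subseteq> B \<and> B \<subseteq> S \<longrightarrow> B \<in> p)
     \<and> (\<forall>A. A \<subseteq> S \<longrightarrow> A \<in> p \<or> S - A \<in> p)}"

definition beta_closure :: "('a, 'b) monoid_scheme \<Rightarrow> 'a set \<Rightarrow> 'a set set set" where
  "beta_closure G A = {p \<in> ultrafilters (carrier G). A \<in> p}"

text \<open>\<open>left_quotient G x A\<close> is the set \<open>x\<^sup>-\<^sup>1A\<close>.\<close>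

definition left_quotient :: "('a, 'b) monoid_scheme \<Rightarrow> 'a \<Rightarrow> 'a set \<Rightarrow> 'a set" where
  "left_quotient G x A = {y \<in> carrier G. x \<otimes>\<^bsub>G\<^esub> y \<in> A}"

definition beta_mult :: "('a, 'b) monoid_scheme \<Rightarrow> 'a set set \<Rightarrow> 'a set set \<Rightarrow> 'a set set" where
  "beta_mult G p q =
     {A. A \<subseteq> carrier G \<and> {x \<in> carrier G. left_quotient G x A \<in> q} \<in> p}"

definition beta_left_ideal :: "('a, 'b) monoid_scheme \<Rightarrow> 'a set set set \<Rightarrow> bool" where
  "beta_left_ideal G I \<longleftrightarrow> I \<noteq> {} \<and> I \<subseteq> ultrafilters (carrier G)
     \<and> (\<forall>p\<in>ultrafilters (carrier G). \<forall>q\<in>I. beta_mult G p q \<in> I)"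

definition minimal_left_ideal :: "('a, 'b) monoid_scheme \<Rightarrow> 'a set set set \<Rightarrow> bool" where
  "minimal_left_ideal G L \<longleftrightarrow>
     beta_left_ideal G L \<and> \<not> (\<exists>I. beta_left_ideal G I \<and> I \<subset> L)"

definition beta_K :: "('a, 'b) monoid_scheme \<Rightarrow> 'a set set set" where
  "beta_K G = \<Union> {L. minimal_left_ideal G L}"

definition piecewise_syndetic :: "('a, 'b) monoid_scheme \<Rightarrow> 'a set \<Rightarrow> bool" where
  "piecewise_syndetic G A \<longleftrightarrow> A \<subseteq> carrier G \<and> beta_closure G A \<inter> beta_K G \<noteq> {}"

abbreviation finsets :: "nat set set" where
  "finsets \<equiv> Fpow UNIV"

definition adequate_ultrafilters :: "nat set set set set" where
  "adequate_ultrafilters = {p \<in> ultrafilters finsets.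
     \<forall>\<beta>\<in>finsets. {\<alpha> \<in> finsets. \<alpha> \<inter> \<beta> = {}} \<in> p}"

definition uplus :: "nat set set set \<Rightarrow> nat set set set \<Rightarrow> nat set set set" where
  "uplus p q = {D. D \<subseteq> finsets \<and>
     {\<alpha> \<in> finsets. {\<beta> \<in> finsets. \<alpha> \<inter> \<beta> = {} \<and> \<alpha> \<union> \<beta> \<in> D} \<in> q} \<in> p}"

text \<open>\<open>tuples \<alpha> d\<close> is the Cartesian power \<open>\<alpha>\<^sup>d\<close>; in particular \<open>tuples \<alpha> 0 = {[]}\<close>, also for
  empty \<open>\<alpha>\<close>, so monomial mappings of degree 0 are exactly the constant ones.\<close>

definition tuples :: "nat set \<Rightarrow> nat \<Rightarrow> nat list set" where
  "tuples \<alpha> d = {s. set s \<subseteq> \<alpha> \<and> length s = d}"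

definition list_product :: "('a, 'b) monoid_scheme \<Rightarrow> 'a list \<Rightarrow> 'a" where
  "list_product G xs = foldr (\<otimes>\<^bsub>G\<^esub>) xs \<one>\<^bsub>G\<^esub>"

text \<open>The increasing enumeration of a set \<open>S\<close> with respect to a linear order \<open>r\<close> on a superset of
  \<open>S\<close>; it exists and is unique when \<open>S\<close> is finite.\<close>

definition enumeration :: "('x \<times> 'x) set \<Rightarrow> 'x set \<Rightarrow> 'x list" where
  "enumeration r S =
     (THE xs. distinct xs \<and> set xs = S \<and> sorted_wrt (\<lambda>s t. (s, t) \<in> r) xs)"

definition ordered_product ::
    "('a, 'b) monoid_scheme \<Rightarrow> ('x \<times> 'x) set \<Rightarrow> ('x \<Rightarrow> 'a) \<Rightarrow> 'x set \<Rightarrow> 'a" where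
  "ordered_product G r u S = list_product G (map u (enumeration r S))"

text \<open>Mappings on finite sets are HOL functions on \<open>nat set\<close> whose values at infinite sets are
  unconstrained and irrelevant.\<close>

definition monomial_mapping :: "('a, 'b) monoid_scheme \<Rightarrow> (nat set \<Rightarrow> 'a) \<Rightarrow> bool" where
  "monomial_mapping G Q \<longleftrightarrow>
     (\<exists>d u r. u \<in> tuples UNIV d \<rightarrow> carrier G \<and> linear_order_on (tuples UNIV d) r
        \<and> (\<forall>\<alpha>\<in>finsets. Q \<alpha> = ordered_product G r u (tuples \<alpha> d)))"

definition polynomial_mapping :: "('a, 'b) monoid_scheme \<Rightarrow> (nat set \<Rightarrow> 'a) \<Rightarrow> bool" where
  "polynomial_mapping G P \<longleftrightarrow>
     (\<exists>Qs. (\<forall>Q\<in>set Qs. monomial_mapping G Q)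
        \<and> (\<forall>\<alpha>\<in>finsets. P \<alpha> = list_product G (map (\<lambda>Q. Q \<alpha>) Qs)))"

end

theory Submission
  imports Defs "HOL-Library.Multiset_Order"
begin

text \<open>A minimal left ideal \<open>L\<close> is a minimal compact \<open>G\<close>-space, so finitely many translates of the open set
  given by \<open>A\<close> cover it, and the claim is a topological polynomial recurrence theorem along \<open>v\<close>. It is
  proved by PET induction. Refine the lower central series to a filtration \<open>\<Gamma>\<close> in which every element
  of \<open>G\<close> sits at depth \<open>d\<close>, a bound for the degrees involved; polynomial mappings then form groups
  indexed by a level such that differencing in \<open>\<alpha>\<close> and taking commutators with constants both raise the
  level, and the levels terminate. For a finite system \<open>R\<close>, take \<open>c\<close> in a class of highest level that
  is present in \<open>R\<close>. The system of all \<open>\<alpha> \<mapsto> P(\<beta>)\<inverse> P(\<beta> \<union> \<alpha>) c(\<alpha>)\<inverse>\<close> has fewer classes at that level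
  and no new ones at lower levels, so it is recurrent by induction. Colour focusing, with the
  finitely many translates of \<open>A\<close> as colours and with all finite unions kept inside a given member of
  the idempotent \<open>v\<close>, then yields recurrence for \<open>R\<close>.\<close>

subsection \<open>Commutators in the lower central series\<close>

context group
begin

definition commutator :: "'a \<Rightarrow> 'a \<Rightarrow> 'a" where
  "commutator x y = x \<otimes> y \<otimes> inv x \<otimes> inv y"

lemma mult_inv_cancel_left:
  assumes "x \<in> carrier G" "y \<in> carrier G"
  shows "x \<otimes> (inv x \<otimes> y) = y" "inv x \<otimes> (x \<otimes> y) = y"
  using assms by (simp_all add: m_assoc [symmetric])

lemmas group_normalize = m_assoc inv_mult_group mult_inv_cancel_left

lemma commutator_closed [simp]:
  "x \<in> carrier G \<Longrightarrow> y \<in> carrier G \<Longrightarrow> commutator x y \<in> carrier G"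
  by (simp add: commutator_def)

lemma lower_central_subset: "lower_central G n \<subseteq> carrier G"
proof (induction n)
  case (Suc n)
  then have "{h \<otimes> g \<otimes> inv h \<otimes> inv g | h g. h \<in> lower_central G n \<and> g \<in> carrier G} \<subseteq> carrier G"
    by auto
  then show ?case
    by (simp add: generate_incl)
qed simp

lemma lower_central_subgroup: "subgroup (lower_central G n) G"
proof (cases n)
  case 0
  then show ?thesis by (simp add: subgroup_self)
next
  case (Suc m)
  then show ?thesis
    using lower_central_subset [of m] by (auto intro!: generate_is_subgroup)
qed

lemma lower_central_mem: "x \<in> lower_central G n \<Longrightarrow> x \<in> carrier G"
  using lower_central_subset by blast

lemma commutator_lower_central_Suc:
  "h \<in> lower_central G n \<Longrightarrow> g \<in> carrier G \<Longrightarrow> commutator h g \<in> lower_central G (Suc n)"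
  by (auto simp: commutator_def intro!: generate.incl)

text \<open>Conjugation by \<open>y\<close> sends the commutator of \<open>h\<close> and
  \<open>g\<close> to that of their conjugates, and the conjugate of \<open>h\<close> stays at depth
  \<open>n\<close> by induction; so generators go to generators.\<close>

lemma lower_central_conj:
  assumes "x \<in> lower_central G n" "y \<in> carrier G"
  shows "y \<otimes> x \<otimes> inv y \<in> lower_central G n"
  using assms
proof (induction n arbitrary: x)
  case (Suc n)
  let ?S = "{h \<otimes> g \<otimes> inv h \<otimes> inv g | h g. h \<in> lower_central G n \<and> g \<in> carrier G}"
  have S: "?S \<subseteq> carrier G"
    using lower_central_mem by auto
  have *: "y \<otimes> s \<otimes> inv y \<in> lower_central G (Suc n)" if "s \<in> ?S" for s
  proof -
    from that obtain h g where s: "s = h \<otimes> g \<otimes> inv h \<otimes> inv g" "h \<in> lower_central G n" "g \<in> carrier G"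
      by blast
    have h: "h \<in> carrier G" using s lower_central_mem by blast
    have "y \<otimes> s \<otimes> inv y = commutator (y \<otimes> h \<otimes> inv y) (y \<otimes> g \<otimes> inv y)"
      using s h Suc.prems by (simp add: commutator_def group_normalize)
    moreover have "y \<otimes> h \<otimes> inv y \<in> lower_central G n"
      using Suc s by blast
    ultimately show ?thesis
      using commutator_lower_central_Suc Suc.prems(2) s(3) by simp
  qed
  have "x \<in> generate G ?S" using Suc.prems by simp
  then show ?case
  proof (induction x rule: generate.induct)
    case one
    then show ?case using Suc.prems(2) subgroup.one_closed [OF lower_central_subgroup, of "Suc n"]
      by (simp del: lower_central.simps)
  next
    case (incl h)
    then show ?case using * by blast
  next
    case (inv h)
    then have h: "h \<in> carrier G" using S by blast
    from inv have "inv (y \<otimes> h \<otimes> inv y) \<in> lower_central G (Suc n)"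
      using * subgroup.m_inv_closed [OF lower_central_subgroup] by blast
    moreover have "inv (y \<otimes> h \<otimes> inv y) = y \<otimes> inv h \<otimes> inv y"
      using h Suc.prems(2) by (simp add: group_normalize)
    ultimately show ?case by simp
  next
    case (eng h1 h2)
    have h: "h1 \<in> carrier G" "h2 \<in> carrier G"
      using eng(1,2) generate_incl [OF S] by blast+
    have "y \<otimes> (h1 \<otimes> h2) \<otimes> inv y = (y \<otimes> h1 \<otimes> inv y) \<otimes> (y \<otimes> h2 \<otimes> inv y)"
      using h Suc.prems(2) by (simp add: group_normalize)
    moreover have "\<dots> \<in> lower_central G (Suc n)"
      using eng(3,4) by (rule subgroup.m_closed [OF lower_central_subgroup])
    ultimately show ?case by (simp only:)
  qed
qed simp

text \<open>The commutator of \<open>h\<close> and \<open>g\<close> is \<open>h\<close> times a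
  conjugate of \<open>inv h\<close>, and normality keeps both factors at depth
  \<open>n\<close>.\<close>

lemma lower_central_Suc_subset: "lower_central G (Suc n) \<subseteq> lower_central G n"
proof -
  have "{h \<otimes> g \<otimes> inv h \<otimes> inv g | h g. h \<in> lower_central G n \<and> g \<in> carrier G} \<subseteq> lower_central G n"
  proof clarify
    fix h g assume hg: "h \<in> lower_central G n" "g \<in> carrier G"
    have "h \<otimes> (g \<otimes> inv h \<otimes> inv g) \<in> lower_central G n"
      using hg lower_central_conj subgroup.m_closed subgroup.m_inv_closed lower_central_subgroup
      by metis
    then show "h \<otimes> g \<otimes> inv h \<otimes> inv g \<in> lower_central G n"
      using hg lower_central_mem by (simp add: m_assoc)
  qed
  then show ?thesis
    using generate_subgroup_incl [OF _ lower_central_subgroup] by simp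
qed

lemma lower_central_antimono: "m \<le> n \<Longrightarrow> lower_central G n \<subseteq> lower_central G m"
  by (induction rule: dec_induct) (use lower_central_Suc_subset in blast)+

text \<open>Takes the place of the Hall--Witt identity: up to conjugation, a commutator with
  \<open>commutator h g\<close> is one of \<open>f\<close> with a conjugate of \<open>inv h\<close>,
  times one of \<open>e\<close> with some element of the group. Both can be estimated by induction
  on the depth of \<open>h\<close>.\<close>

lemma commutator_commutator:
  assumes "x \<in> carrier G" "h \<in> carrier G" "g \<in> carrier G"
  defines "e \<equiv> commutator x h" and "f \<equiv> commutator x g" and "k \<equiv> g \<otimes> inv h \<otimes> inv g"
  shows "commutator x (commutator h g)
    = e \<otimes> (h \<otimes> commutator f k \<otimes> inv h) \<otimes> inv e \<otimes> commutator e (h \<otimes> k \<otimes> f \<otimes> g)"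
  using assms(1-3) by (simp add: assms(4-) commutator_def group_normalize)

text \<open>The extra \<open>Suc\<close> arises because the series is counted from 0. In the
  induction on \<open>b\<close> the depth \<open>a\<close> must be general: \<open>f\<close> has
  depth \<open>Suc a\<close> and \<open>k\<close> depth \<open>b\<close>, while \<open>e\<close> has
  depth \<open>Suc (a + b)\<close> and gains one more from the outer commutator.\<close>

lemma commutator_lower_central:
  "x \<in> lower_central G a \<Longrightarrow> y \<in> lower_central G b \<Longrightarrow> commutator x y \<in> lower_central G (Suc (a + b))"
proof (induction b arbitrary: a x y)
  case 0
  then show ?case using commutator_lower_central_Suc by simp
next
  case (Suc b)
  let ?N = "lower_central G (Suc (a + Suc b))"
  let ?S = "{h \<otimes> g \<otimes> inv h \<otimes> inv g | h g. h \<in> lower_central G b \<and> g \<in> carrier G}"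
  have x: "x \<in> carrier G" using Suc.prems lower_central_mem by blast
  note N_mult = subgroup.m_closed [OF lower_central_subgroup, of _ "Suc (a + Suc b)"]
  note N_conj = lower_central_conj [of _ "Suc (a + Suc b)"]
  have S: "?S \<subseteq> carrier G"
    using lower_central_mem by auto
  have *: "commutator x s \<in> ?N" if "s \<in> ?S" for s
  proof -
    from that obtain h g where s: "s = commutator h g" "h \<in> lower_central G b" "g \<in> carrier G"
      unfolding commutator_def by blast
    have h: "h \<in> carrier G" using s lower_central_mem by blast
    define e f k where "e = commutator x h" and "f = commutator x g" and "k = g \<otimes> inv h \<otimes> inv g"
    have e: "e \<in> lower_central G (Suc (a + b))"
      unfolding e_def using Suc.IH Suc.prems(1) s(2) .
    have f: "f \<in> lower_central G (Suc a)"
      unfolding f_def using commutator_lower_central_Suc Suc.prems(1) s(3) .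
    have k: "k \<in> lower_central G b"
      unfolding k_def using s lower_central_conj subgroup.m_inv_closed lower_central_subgroup by metis
    note mem = e [THEN lower_central_mem] f [THEN lower_central_mem] k [THEN lower_central_mem]
    have "commutator f k \<in> ?N"
      using Suc.IH [OF f k] by simp
    then have "e \<otimes> (h \<otimes> commutator f k \<otimes> inv h) \<otimes> inv e \<in> ?N"
      using N_conj h mem(1) by blast
    moreover have "commutator e (h \<otimes> k \<otimes> f \<otimes> g) \<in> ?N"
      using commutator_lower_central_Suc [OF e, of "h \<otimes> k \<otimes> f \<otimes> g"] h s(3) mem
      by (simp del: lower_central.simps)
    ultimately show ?thesis
      unfolding s(1) commutator_commutator [OF x h s(3)] e_def [symmetric] f_def [symmetric]
        k_def [symmetric] by (rule N_mult)
  qed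
  have "y \<in> generate G ?S" using Suc.prems by simp
  then show ?case
  proof (induction y rule: generate.induct)
    case one
    then show ?case using x subgroup.one_closed [OF lower_central_subgroup, of "Suc (a + Suc b)"]
      by (simp del: lower_central.simps add: commutator_def)
  next
    case (incl h)
    then show ?case using * by blast
  next
    case (inv h)
    then have h: "h \<in> carrier G" using S by blast
    have "inv (commutator x h) \<in> ?N"
      using * [OF inv] subgroup.m_inv_closed [OF lower_central_subgroup] by blast
    then have "inv h \<otimes> inv (commutator x h) \<otimes> inv (inv h) \<in> ?N"
      using h N_conj inv_closed by blast
    moreover have "inv h \<otimes> inv (commutator x h) \<otimes> inv (inv h) = commutator x (inv h)"
      using x h by (simp add: commutator_def group_normalize)
    ultimately show ?case by simp
  next
    case (eng h1 h2)
    have h: "h1 \<in> carrier G" "h2 \<in> carrier G"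
      using eng(1,2) generate_incl [OF S] by blast+
    have "commutator x (h1 \<otimes> h2) = commutator x h1 \<otimes> (h1 \<otimes> commutator x h2 \<otimes> inv h1)"
      using x h by (simp add: commutator_def group_normalize)
    moreover have "\<dots> \<in> ?N"
      using eng(3) N_conj [OF eng(4) h(1)] by (rule N_mult)
    ultimately show ?case by (simp only:)
  qed
qed

end

subsection \<open>Polynomial maps with respect to a filtration\<close>

text \<open>The index is shifted by one against \<open>lower_central\<close>, so that depths add
  under commutators. Since \<open>\<Gamma> 1\<close> is the whole group, a commutator with any
  element gains one level; \<open>\<Gamma> N = {\<one>}\<close> encodes nilpotency.\<close>

locale group_filtration = group G for G :: "('a, 'b) monoid_scheme" (structure) +
  fixes \<Gamma> :: "nat \<Rightarrow> 'a set" and N :: nat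
  assumes filtration_subgroup: "subgroup (\<Gamma> i) G"
    and filtration_antimono: "i \<le> j \<Longrightarrow> \<Gamma> j \<subseteq> \<Gamma> i"
    and filtration_0: "\<Gamma> 0 = carrier G"
    and filtration_1: "\<Gamma> 1 = carrier G"
    and filtration_commutator: "x \<in> \<Gamma> i \<Longrightarrow> y \<in> \<Gamma> j \<Longrightarrow> commutator x y \<in> \<Gamma> (i + j)"
    and filtration_N: "\<Gamma> N = {\<one>}"
begin

lemma filtration_mem: "x \<in> \<Gamma> i \<Longrightarrow> x \<in> carrier G"
  by (rule subgroup.mem_carrier [OF filtration_subgroup])

lemma filtration_mono: "x \<in> \<Gamma> j \<Longrightarrow> i \<le> j \<Longrightarrow> x \<in> \<Gamma> i"
  using filtration_antimono by blast

lemma filtration_one: "\<one> \<in> \<Gamma> i"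
  by (rule subgroup.one_closed [OF filtration_subgroup])

lemma filtration_mult: "x \<in> \<Gamma> i \<Longrightarrow> y \<in> \<Gamma> i \<Longrightarrow> x \<otimes> y \<in> \<Gamma> i"
  by (rule subgroup.m_closed [OF filtration_subgroup])

lemma filtration_inv: "x \<in> \<Gamma> i \<Longrightarrow> inv x \<in> \<Gamma> i"
  by (rule subgroup.m_inv_closed [OF filtration_subgroup])

text \<open>The analogue of a Host--Kra cube group: \<open>cubes i M\<close> describes the restrictions to the cube
  \<open>Pow M\<close> of polynomial maps with respect to the shifted filtration \<open>\<lambda>j. \<Gamma> (i + j)\<close>. It is a group
  of functions by construction, and an ordered product of monomials lies in it at sight.\<close>

inductive_set cubes :: "nat \<Rightarrow> nat set \<Rightarrow> (nat set \<Rightarrow> 'a) set" for i M where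
  one: "(\<lambda>_. \<one>) \<in> cubes i M"
| gen: "\<gamma> \<subseteq> M \<Longrightarrow> g \<in> \<Gamma> (i + card \<gamma>) \<Longrightarrow> (\<lambda>\<alpha>. if \<gamma> \<subseteq> \<alpha> then g else \<one>) \<in> cubes i M"
| mult: "x \<in> cubes i M \<Longrightarrow> y \<in> cubes i M \<Longrightarrow> (\<lambda>\<alpha>. x \<alpha> \<otimes> y \<alpha>) \<in> cubes i M"

lemma cubes_values: "x \<in> cubes i M \<Longrightarrow> x \<alpha> \<in> \<Gamma> i"
  by (induction rule: cubes.induct)
    (auto intro: filtration_one filtration_mult filtration_mono)

lemma cubes_closed [simp]: "x \<in> cubes i M \<Longrightarrow> x \<alpha> \<in> carrier G"
  using cubes_values filtration_mem by blast

lemma cubes_antimono: "x \<in> cubes j M \<Longrightarrow> i \<le> j \<Longrightarrow> x \<in> cubes i M"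
proof (induction rule: cubes.induct)
  case (gen \<gamma> g)
  then have "g \<in> \<Gamma> (i + card \<gamma>)"
    using filtration_mono add_le_mono1 by blast
  then show ?case using gen cubes.gen by blast
qed (auto intro: cubes.intros)

lemma cubes_const: "g \<in> \<Gamma> i \<Longrightarrow> (\<lambda>_. g) \<in> cubes i M"
  using cubes.gen [of "{}" M g i] by simp

lemma cubes_inv: "x \<in> cubes i M \<Longrightarrow> (\<lambda>\<alpha>. inv (x \<alpha>)) \<in> cubes i M"
proof (induction rule: cubes.induct)
  case one
  then show ?case using cubes.one by simp
next
  case (gen \<gamma> g)
  have "(\<lambda>\<alpha>. inv (if \<gamma> \<subseteq> \<alpha> then g else \<one>)) = (\<lambda>\<alpha>. if \<gamma> \<subseteq> \<alpha> then inv g else \<one>)"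
    by auto
  then show ?case
    using cubes.gen gen filtration_inv by simp
next
  case (mult x y)
  have "(\<lambda>\<alpha>. inv (x \<alpha> \<otimes> y \<alpha>)) = (\<lambda>\<alpha>. inv (y \<alpha>) \<otimes> inv (x \<alpha>))"
    using mult by (simp add: inv_mult_group)
  then show ?case
    using cubes.mult mult by simp
qed

text \<open>The two generators fail to commute only above \<open>\<delta> \<union> \<gamma>\<close>,
  where the error is \<open>commutator h g\<close>. Its depth is the sum of the two depths, and the
  union has at most \<open>card \<delta> + card \<gamma>\<close> elements.\<close>

lemma cubes_conj_gen:
  assumes M: "finite M" and "\<gamma> \<subseteq> M" "\<delta> \<subseteq> M" "g \<in> \<Gamma> (i + card \<gamma>)" "h \<in> \<Gamma> (card \<delta>)"
  shows "(\<lambda>\<alpha>. (if \<delta> \<subseteq> \<alpha> then h else \<one>) \<otimes> (if \<gamma> \<subseteq> \<alpha> then g else \<one>) \<otimes> inv (if \<delta> \<subseteq> \<alpha> then h else \<one>))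
    \<in> cubes i M" (is "?f \<in> _")
proof -
  have gh: "g \<in> carrier G" "h \<in> carrier G"
    using assms filtration_mem by blast+
  have "commutator h g \<in> \<Gamma> (card \<delta> + (i + card \<gamma>))"
    using assms filtration_commutator by blast
  moreover have "i + card (\<delta> \<union> \<gamma>) \<le> card \<delta> + (i + card \<gamma>)"
    using card_Un_le [of \<delta> \<gamma>] by simp
  ultimately have "commutator h g \<in> \<Gamma> (i + card (\<delta> \<union> \<gamma>))"
    by (rule filtration_mono)
  then have "(\<lambda>\<alpha>. if \<delta> \<union> \<gamma> \<subseteq> \<alpha> then commutator h g else \<one>) \<in> cubes i M"
    using assms by (intro cubes.gen) auto
  moreover have "(\<lambda>\<alpha>. if \<gamma> \<subseteq> \<alpha> then g else \<one>) \<in> cubes i M"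
    using assms by (intro cubes.gen) auto
  ultimately have "(\<lambda>\<alpha>. (if \<delta> \<union> \<gamma> \<subseteq> \<alpha> then commutator h g else \<one>) \<otimes> (if \<gamma> \<subseteq> \<alpha> then g else \<one>)) \<in> cubes i M"
    by (rule cubes.mult)
  moreover have "?f = (\<lambda>\<alpha>. (if \<delta> \<union> \<gamma> \<subseteq> \<alpha> then commutator h g else \<one>) \<otimes> (if \<gamma> \<subseteq> \<alpha> then g else \<one>))"
    using gh by (auto simp: commutator_def group_normalize)
  ultimately show ?thesis by simp
qed

lemma cubes_normal:
  assumes M: "finite M" and x: "x \<in> cubes i M" and y: "y \<in> cubes 0 M"
  shows "(\<lambda>\<alpha>. y \<alpha> \<otimes> x \<alpha> \<otimes> inv (y \<alpha>)) \<in> cubes i M"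
  using y x
proof (induction arbitrary: x rule: cubes.induct)
  case one
  then show ?case by simp
next
  case (gen \<delta> h)
  let ?h = "\<lambda>\<alpha>. if \<delta> \<subseteq> \<alpha> then h else \<one>"
  have h: "h \<in> carrier G" using gen filtration_mem by blast
  from gen(3) show ?case
  proof (induction rule: cubes.induct)
    case one
    have "(\<lambda>\<alpha>. ?h \<alpha> \<otimes> \<one> \<otimes> inv (?h \<alpha>)) = (\<lambda>_. \<one>)"
      using h by auto
    then show ?case using cubes.one by simp
  next
    case (gen \<gamma> g)
    then show ?case
      using cubes_conj_gen [OF M] \<open>\<delta> \<subseteq> M\<close> \<open>h \<in> \<Gamma> (0 + card \<delta>)\<close> by simp
  next
    case (mult x y)
    have "(\<lambda>\<alpha>. ?h \<alpha> \<otimes> (x \<alpha> \<otimes> y \<alpha>) \<otimes> inv (?h \<alpha>)) =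
      (\<lambda>\<alpha>. (?h \<alpha> \<otimes> x \<alpha> \<otimes> inv (?h \<alpha>)) \<otimes> (?h \<alpha> \<otimes> y \<alpha> \<otimes> inv (?h \<alpha>)))"
      using h mult(1,2) by (auto simp: group_normalize)
    then show ?case
      using cubes.mult [OF mult(3,4)] by simp
  qed
next
  case (mult y z)
  have "(\<lambda>\<alpha>. y \<alpha> \<otimes> (z \<alpha> \<otimes> x \<alpha> \<otimes> inv (z \<alpha>)) \<otimes> inv (y \<alpha>)) =
    (\<lambda>\<alpha>. y \<alpha> \<otimes> z \<alpha> \<otimes> x \<alpha> \<otimes> inv (y \<alpha> \<otimes> z \<alpha>))"
    using mult by (simp add: group_normalize)
  then show ?case
    using mult(3) [OF mult(4) [OF mult(5)]] by simp
qed

text \<open>On a generator, the commutator with \<open>g\<close> makes the coefficient one level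
  deeper and leaves \<open>\<gamma>\<close> unchanged. For products the commutator is expanded in
  its second argument, and normality absorbs the conjugation.\<close>

lemma cubes_commutator_const:
  assumes M: "finite M" and x: "x \<in> cubes i M" and g: "g \<in> carrier G"
  shows "(\<lambda>\<alpha>. commutator g (x \<alpha>)) \<in> cubes (Suc i) M"
  using x
proof (induction rule: cubes.induct)
  case one
  then show ?case using g cubes.one by (simp add: commutator_def)
next
  case (gen \<gamma> h)
  then have "commutator g h \<in> \<Gamma> (1 + (i + card \<gamma>))"
    using g filtration_1 filtration_commutator by blast
  moreover have "(\<lambda>\<alpha>. commutator g (if \<gamma> \<subseteq> \<alpha> then h else \<one>)) = (\<lambda>\<alpha>. if \<gamma> \<subseteq> \<alpha> then commutator g h else \<one>)"
    using g by (auto simp: commutator_def)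
  ultimately show ?case
    using gen cubes.gen [of \<gamma> M "commutator g h" "Suc i"] by simp
next
  case (mult x y)
  have "(\<lambda>\<alpha>. commutator g (x \<alpha> \<otimes> y \<alpha>)) =
    (\<lambda>\<alpha>. commutator g (x \<alpha>) \<otimes> (x \<alpha> \<otimes> commutator g (y \<alpha>) \<otimes> inv (x \<alpha>)))"
    using mult g by (simp add: commutator_def group_normalize)
  then show ?case
    using mult cubes_normal [OF M] cubes_antimono [of _ i M 0] by (simp add: cubes.mult)
qed

text \<open>\<open>y\<close> is the restriction to \<open>M\<close> and \<open>z\<close> the
  difference in direction \<open>\<beta>\<close>. A generator at some \<open>\<gamma>\<close> not
  contained in \<open>M\<close> is trivial on \<open>M\<close> and contributes to the difference a
  generator at \<open>\<gamma> \<inter> M\<close>; the points lost from \<open>\<gamma>\<close> pay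
  for the higher level.\<close>

lemma cubes_difference:
  assumes M: "finite M" and \<beta>: "finite \<beta>" "M \<inter> \<beta> = {}" and x: "x \<in> cubes i (M \<union> \<beta>)"
  shows "\<exists>y\<in>cubes i M. \<exists>z\<in>cubes (Suc i) M. \<forall>\<alpha>\<subseteq>M. x \<alpha> = y \<alpha> \<and> x (\<alpha> \<union> \<beta>) = y \<alpha> \<otimes> z \<alpha>"
  using x
proof (induction rule: cubes.induct)
  case one
  show ?case
    by (intro bexI [of _ "\<lambda>_. \<one>"]) (auto intro: cubes.one)
next
  case (gen \<gamma> g)
  then have g: "g \<in> carrier G" using filtration_mem by blast
  show ?case
  proof (cases "\<gamma> \<subseteq> M")
    case True
    then show ?thesis
      using gen g \<beta>(2)
      by (intro bexI [of _ "\<lambda>\<alpha>. if \<gamma> \<subseteq> \<alpha> then g else \<one>"] bexI [of _ "\<lambda>_. \<one>"])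
        (auto intro: cubes.intros)
  next
    case False
    have "card (\<gamma> \<inter> M) < card \<gamma>"
      using False gen(1) M \<beta> finite_subset [of \<gamma> "M \<union> \<beta>"] by (intro psubset_card_mono) auto
    then have "g \<in> \<Gamma> (Suc i + card (\<gamma> \<inter> M))"
      using gen(2) filtration_mono by simp
    moreover have "\<gamma> \<subseteq> \<alpha> \<union> \<beta> \<longleftrightarrow> \<gamma> \<inter> M \<subseteq> \<alpha>" "\<not> \<gamma> \<subseteq> \<alpha>" if "\<alpha> \<subseteq> M" for \<alpha>
      using that gen(1) \<beta>(2) False by auto
    ultimately show ?thesis
      using g
      by (intro bexI [of _ "\<lambda>_. \<one>"] bexI [of _ "\<lambda>\<alpha>. if \<gamma> \<inter> M \<subseteq> \<alpha> then g else \<one>"])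
        (auto intro: cubes.intros)
  qed
next
  case (mult x x')
  from mult(3) obtain y z where yz: "y \<in> cubes i M" "z \<in> cubes (Suc i) M"
    and x_eq: "\<forall>\<alpha>\<subseteq>M. x \<alpha> = y \<alpha> \<and> x (\<alpha> \<union> \<beta>) = y \<alpha> \<otimes> z \<alpha>" by blast
  from mult(4) obtain y' z' where yz': "y' \<in> cubes i M" "z' \<in> cubes (Suc i) M"
    and x'_eq: "\<forall>\<alpha>\<subseteq>M. x' \<alpha> = y' \<alpha> \<and> x' (\<alpha> \<union> \<beta>) = y' \<alpha> \<otimes> z' \<alpha>" by blast
  note * = yz yz'
  \<comment> \<open>Moving \<open>z\<close> to the right past \<open>y'\<close> conjugates it by
    \<open>inv (y' \<alpha>)\<close>, which normality allows.\<close>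
  let ?w = "\<lambda>\<alpha>. inv (y' \<alpha>) \<otimes> z \<alpha> \<otimes> inv (inv (y' \<alpha>)) \<otimes> z' \<alpha>"
  have "(\<lambda>\<alpha>. inv (y' \<alpha>) \<otimes> z \<alpha> \<otimes> inv (inv (y' \<alpha>))) \<in> cubes (Suc i) M"
    using * cubes_antimono [of _ i M 0] by (intro cubes_normal [OF M] cubes_inv) simp_all
  from cubes.mult [OF this *(4)] have w: "?w \<in> cubes (Suc i) M" .
  have y: "(\<lambda>\<alpha>. y \<alpha> \<otimes> y' \<alpha>) \<in> cubes i M"
    using *(1,3) by (rule cubes.mult)
  have "y \<alpha> \<otimes> z \<alpha> \<otimes> (y' \<alpha> \<otimes> z' \<alpha>) = y \<alpha> \<otimes> y' \<alpha> \<otimes> ?w \<alpha>" for \<alpha>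
    using * by (simp add: group_normalize)
  then have "\<forall>\<alpha>\<subseteq>M. x \<alpha> \<otimes> x' \<alpha> = y \<alpha> \<otimes> y' \<alpha>
      \<and> x (\<alpha> \<union> \<beta>) \<otimes> x' (\<alpha> \<union> \<beta>) = y \<alpha> \<otimes> y' \<alpha> \<otimes> ?w \<alpha>"
    using x_eq x'_eq by metis
  then show ?case
    by (intro bexI [OF _ y] bexI [OF _ w])
qed

text \<open>The set \<open>\<beta>\<close> outside of which a map is required to be polynomial is needed because
  \<open>\<alpha> \<mapsto> P (\<alpha> \<union> \<beta>)\<close> is well behaved only for \<open>\<alpha>\<close> disjoint from \<open>\<beta>\<close>.\<close>

definition poly_maps :: "nat \<Rightarrow> nat set \<Rightarrow> (nat set \<Rightarrow> 'a) set" where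
  "poly_maps i \<beta> = {P \<in> finsets \<rightarrow> carrier G.
     \<forall>M. finite M \<and> M \<inter> \<beta> = {} \<longrightarrow> (\<exists>x\<in>cubes i M. \<forall>\<alpha>\<subseteq>M. P \<alpha> = x \<alpha>)}"

lemma poly_maps_closed: "P \<in> poly_maps i \<beta> \<Longrightarrow> finite \<alpha> \<Longrightarrow> P \<alpha> \<in> carrier G"
  by (auto simp: poly_maps_def Fpow_def)

lemma poly_mapsE:
  assumes "P \<in> poly_maps i \<beta>" "finite M" "M \<inter> \<beta> = {}"
  obtains x where "x \<in> cubes i M" "\<And>\<alpha>. \<alpha> \<subseteq> M \<Longrightarrow> P \<alpha> = x \<alpha>"
  using assms unfolding poly_maps_def by blast

lemma poly_mapsI:
  assumes "\<And>\<alpha>. finite \<alpha> \<Longrightarrow> P \<alpha> \<in> carrier G"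
    and "\<And>M. finite M \<Longrightarrow> M \<inter> \<beta> = {} \<Longrightarrow> \<exists>x\<in>cubes i M. \<forall>\<alpha>\<subseteq>M. P \<alpha> = x \<alpha>"
  shows "P \<in> poly_maps i \<beta>"
  using assms by (auto simp: poly_maps_def Fpow_def)

lemma poly_maps_antimono:
  assumes "P \<in> poly_maps j \<beta>" "i \<le> j"
  shows "P \<in> poly_maps i \<beta>"
proof (rule poly_mapsI)
  fix M :: "nat set" assume "finite M" "M \<inter> \<beta> = {}"
  with assms(1) obtain x where "x \<in> cubes j M" "\<And>\<alpha>. \<alpha> \<subseteq> M \<Longrightarrow> P \<alpha> = x \<alpha>"
    by (rule poly_mapsE) blast
  then show "\<exists>x\<in>cubes i M. \<forall>\<alpha>\<subseteq>M. P \<alpha> = x \<alpha>"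
    using cubes_antimono [OF _ assms(2)] by (intro bexI [of _ x]) auto
qed (use assms poly_maps_closed in auto)

lemma poly_maps_mono:
  assumes "P \<in> poly_maps i \<beta>" "\<beta> \<subseteq> \<beta>'"
  shows "P \<in> poly_maps i \<beta>'"
proof (rule poly_mapsI)
  fix M :: "nat set" assume "finite M" "M \<inter> \<beta>' = {}"
  with assms(2) have "finite M" "M \<inter> \<beta> = {}" by auto
  with assms(1) obtain x where "x \<in> cubes i M" "\<And>\<alpha>. \<alpha> \<subseteq> M \<Longrightarrow> P \<alpha> = x \<alpha>"
    by (rule poly_mapsE) blast
  then show "\<exists>x\<in>cubes i M. \<forall>\<alpha>\<subseteq>M. P \<alpha> = x \<alpha>"
    by auto
qed (use assms poly_maps_closed in auto)

lemma poly_maps_mult: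
  assumes P: "P \<in> poly_maps i \<beta>" and Q: "Q \<in> poly_maps i \<beta>"
  shows "(\<lambda>\<alpha>. P \<alpha> \<otimes> Q \<alpha>) \<in> poly_maps i \<beta>"
proof (rule poly_mapsI)
  fix M :: "nat set" assume M: "finite M" "M \<inter> \<beta> = {}"
  from P M obtain x where x: "x \<in> cubes i M" "\<And>\<alpha>. \<alpha> \<subseteq> M \<Longrightarrow> P \<alpha> = x \<alpha>"
    by (rule poly_mapsE) blast
  from Q M obtain y where y: "y \<in> cubes i M" "\<And>\<alpha>. \<alpha> \<subseteq> M \<Longrightarrow> Q \<alpha> = y \<alpha>"
    by (rule poly_mapsE) blast
  show "\<exists>x\<in>cubes i M. \<forall>\<alpha>\<subseteq>M. P \<alpha> \<otimes> Q \<alpha> = x \<alpha>"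
    using x(2) y(2) by (intro bexI [OF _ cubes.mult [OF x(1) y(1)]]) simp
qed (use assms poly_maps_closed in auto)

lemma poly_maps_inv:
  assumes P: "P \<in> poly_maps i \<beta>"
  shows "(\<lambda>\<alpha>. inv (P \<alpha>)) \<in> poly_maps i \<beta>"
proof (rule poly_mapsI)
  fix M :: "nat set" assume M: "finite M" "M \<inter> \<beta> = {}"
  from P M obtain x where x: "x \<in> cubes i M" "\<And>\<alpha>. \<alpha> \<subseteq> M \<Longrightarrow> P \<alpha> = x \<alpha>"
    by (rule poly_mapsE) blast
  show "\<exists>x\<in>cubes i M. \<forall>\<alpha>\<subseteq>M. inv (P \<alpha>) = x \<alpha>"
    using x(2) by (intro bexI [OF _ cubes_inv [OF x(1)]]) simp
qed (use assms poly_maps_closed in auto)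

lemma poly_maps_one: "(\<lambda>_. \<one>) \<in> poly_maps i \<beta>"
  by (rule poly_mapsI) (auto intro!: bexI [OF _ cubes.one])

lemma poly_maps_commutator_const:
  assumes "P \<in> poly_maps i \<beta>" "g \<in> carrier G"
  shows "(\<lambda>\<alpha>. commutator g (P \<alpha>)) \<in> poly_maps (Suc i) \<beta>"
proof (rule poly_mapsI)
  fix M :: "nat set" assume M: "finite M" "M \<inter> \<beta> = {}"
  from assms(1) M obtain x where x: "x \<in> cubes i M" "\<And>\<alpha>. \<alpha> \<subseteq> M \<Longrightarrow> P \<alpha> = x \<alpha>"
    by (rule poly_mapsE) blast
  show "\<exists>x\<in>cubes (Suc i) M. \<forall>\<alpha>\<subseteq>M. commutator g (P \<alpha>) = x \<alpha>"
    using x(2) by (intro bexI [OF _ cubes_commutator_const [OF M(1) x(1) assms(2)]]) simp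
qed (use assms poly_maps_closed in auto)

text \<open>On \<open>M\<close> the map is \<open>inv (P \<beta>)\<close> times a conjugate of the
  difference \<open>z\<close>. The normalisation \<open>P {} = \<one>\<close> gives
  \<open>P \<beta> = z {}\<close>, so the constant factor is deep enough too.\<close>

lemma poly_maps_difference:
  assumes P: "P \<in> poly_maps i \<beta>'" and P0: "P {} = \<one>" and \<beta>: "finite \<beta>" "\<beta> \<inter> \<beta>' = {}"
  shows "(\<lambda>\<alpha>. inv (P \<beta>) \<otimes> P (\<beta> \<union> \<alpha>) \<otimes> inv (P \<alpha>)) \<in> poly_maps (Suc i) (\<beta>' \<union> \<beta>)"
proof (rule poly_mapsI)
  fix M :: "nat set" assume M: "finite M" "M \<inter> (\<beta>' \<union> \<beta>) = {}"
  with \<beta> have "finite (M \<union> \<beta>)" "(M \<union> \<beta>) \<inter> \<beta>' = {}" by auto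
  with P obtain x where x: "x \<in> cubes i (M \<union> \<beta>)" "\<And>\<alpha>. \<alpha> \<subseteq> M \<union> \<beta> \<Longrightarrow> P \<alpha> = x \<alpha>"
    by (rule poly_mapsE) blast
  from M have "M \<inter> \<beta> = {}" by blast
  from cubes_difference [OF M(1) \<beta>(1) this x(1)] obtain y z
    where y: "y \<in> cubes i M" and z: "z \<in> cubes (Suc i) M"
      and yz: "\<And>\<alpha>. \<alpha> \<subseteq> M \<Longrightarrow> x \<alpha> = y \<alpha>" "\<And>\<alpha>. \<alpha> \<subseteq> M \<Longrightarrow> x (\<alpha> \<union> \<beta>) = y \<alpha> \<otimes> z \<alpha>"
    by blast
  have "y {} = \<one>"
    using yz(1) [of "{}"] x(2) [of "{}"] P0 by simp
  then have P\<beta>: "P \<beta> = z {}"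
    using yz(2) [of "{}"] x(2) [of \<beta>] z by simp
  have "(\<lambda>\<alpha>. inv (P \<beta>)) \<in> cubes (Suc i) M"
    unfolding P\<beta> using z by (intro cubes_const filtration_inv cubes_values)
  moreover have "(\<lambda>\<alpha>. y \<alpha> \<otimes> z \<alpha> \<otimes> inv (y \<alpha>)) \<in> cubes (Suc i) M"
    using y z cubes_antimono by (intro cubes_normal [OF M(1)]) auto
  ultimately have d: "(\<lambda>\<alpha>. inv (P \<beta>) \<otimes> (y \<alpha> \<otimes> z \<alpha> \<otimes> inv (y \<alpha>))) \<in> cubes (Suc i) M"
    by (rule cubes.mult)
  have "inv (P \<beta>) \<otimes> P (\<beta> \<union> \<alpha>) \<otimes> inv (P \<alpha>) = inv (P \<beta>) \<otimes> (y \<alpha> \<otimes> z \<alpha> \<otimes> inv (y \<alpha>))"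
    if "\<alpha> \<subseteq> M" for \<alpha>
  proof -
    have "P (\<beta> \<union> \<alpha>) = y \<alpha> \<otimes> z \<alpha>" "P \<alpha> = y \<alpha>"
      using that x(2) [of "\<alpha> \<union> \<beta>"] x(2) [of \<alpha>] yz by (auto simp: Un_commute)
    then show ?thesis
      using y z P\<beta> by (simp add: m_assoc)
  qed
  then show "\<exists>x\<in>cubes (Suc i) M. \<forall>\<alpha>\<subseteq>M. inv (P \<beta>) \<otimes> P (\<beta> \<union> \<alpha>) \<otimes> inv (P \<alpha>) = x \<alpha>"
    by (intro bexI [OF _ d]) simp
qed (use P \<beta> poly_maps_closed in auto)

lemma poly_maps_trivial:
  assumes "P \<in> poly_maps N \<beta>" "finite \<alpha>" "\<alpha> \<inter> \<beta> = {}"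
  shows "P \<alpha> = \<one>"
  using poly_mapsE [OF assms] cubes_values filtration_N by (metis order_refl singletonD)

end

subsection \<open>Monomial mappings\<close>

lemma finite_sorted_enumeration_exists:
  assumes "finite S" "linear_order_on T r" "S \<subseteq> T"
  shows "\<exists>xs. distinct xs \<and> set xs = S \<and> sorted_wrt (\<lambda>s t. (s, t) \<in> r) xs"
  using assms(1,3)
proof (induction rule: finite_induct)
  case (insert x S)
  then obtain xs where xs: "distinct xs" "set xs = S" "sorted_wrt (\<lambda>s t. (s, t) \<in> r) xs"
    by auto
  have tot: "(x, y) \<in> r" if "y \<in> S" "(y, x) \<notin> r" for y
    using assms(2) that insert by (auto simp: order_on_defs total_on_def)
  have trans: "trans r"
    using assms(2) by (auto simp: order_on_defs)
  let ?ys = "filter (\<lambda>y. (y, x) \<in> r) xs @ [x] @ filter (\<lambda>y. (y, x) \<notin> r) xs"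
  have "distinct ?ys" "set ?ys = insert x S"
    using xs insert by auto
  moreover have "sorted_wrt (\<lambda>s t. (s, t) \<in> r) ?ys"
    using xs tot by (auto simp: sorted_wrt_append sorted_wrt_filter intro: transD [OF trans])
  ultimately show ?case by blast
qed simp

lemma sorted_enumeration_unique:
  assumes "antisym r" "distinct xs" "distinct ys" "set xs = set ys"
    "sorted_wrt (\<lambda>s t. (s, t) \<in> r) xs" "sorted_wrt (\<lambda>s t. (s, t) \<in> r) ys"
  shows "xs = ys"
  using assms(2-)
proof (induction xs arbitrary: ys)
  case (Cons x xs)
  then obtain y ys' where ys: "ys = y # ys'"
    by (cases ys) auto
  have "x = y"
  proof (rule ccontr)
    assume "x \<noteq> y"
    then have "(x, y) \<in> r" "(y, x) \<in> r"
      using Cons.prems ys by auto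
    then show False
      using \<open>x \<noteq> y\<close> assms(1) by (auto dest: antisymD)
  qed
  moreover have "set xs = set ys'"
    using Cons.prems(1-3) unfolding ys \<open>x = y\<close> by (simp add: insert_ident)
  ultimately show ?case
    using Cons ys by auto
qed simp

lemma enumeration_eqI:
  assumes "linear_order_on T r" "distinct xs" "set xs = S" "sorted_wrt (\<lambda>s t. (s, t) \<in> r) xs"
  shows "enumeration r S = xs"
  unfolding enumeration_def
proof (rule the_equality)
  have "antisym r" using assms(1) by (simp add: order_on_defs)
  then show "ys = xs" if "distinct ys \<and> set ys = S \<and> sorted_wrt (\<lambda>s t. (s, t) \<in> r) ys" for ys
    using sorted_enumeration_unique [of r ys xs] that assms by simp
qed (use assms in simp)

lemma finite_tuples: "finite \<alpha> \<Longrightarrow> finite (tuples \<alpha> d)"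
  unfolding tuples_def by (rule finite_lists_length_eq)

context group
begin

lemma list_product_simps [simp]:
  "list_product G [] = \<one>" "list_product G (x # xs) = x \<otimes> list_product G xs"
  by (simp_all add: list_product_def)

lemma list_product_closed: "set xs \<subseteq> carrier G \<Longrightarrow> list_product G xs \<in> carrier G"
  by (induction xs) auto

lemma list_product_filter:
  assumes "u ` set xs \<subseteq> carrier G"
  shows "list_product G (map u (filter p xs)) = list_product G (map (\<lambda>s. if p s then u s else \<one>) xs)"
  using assms
proof (induction xs)
  case (Cons a xs)
  then have "list_product G (map u (filter p xs)) \<in> carrier G"
    by (intro list_product_closed) auto
  then show ?case using Cons by auto
qed simp

end

context group_filtration
begin

lemma cubes_list_product:
  "(\<And>s. s \<in> set xs \<Longrightarrow> f s \<in> cubes i M) \<Longrightarrow>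
    (\<lambda>\<alpha>. list_product G (map (\<lambda>s. f s \<alpha>) xs)) \<in> cubes i M"
proof (induction xs)
  case Nil
  then show ?case by (simp add: cubes.one)
next
  case (Cons s xs)
  then have "f s \<in> cubes i M" "(\<lambda>\<alpha>. list_product G (map (\<lambda>s. f s \<alpha>) xs)) \<in> cubes i M"
    by simp_all
  from cubes.mult [OF this] show ?case by simp
qed

lemma poly_maps_list_product:
  "(\<And>Q. Q \<in> set Qs \<Longrightarrow> Q \<in> poly_maps i \<beta>) \<Longrightarrow>
    (\<lambda>\<alpha>. list_product G (map (\<lambda>Q. Q \<alpha>) Qs)) \<in> poly_maps i \<beta>"
proof (induction Qs)
  case Nil
  then show ?case by (simp add: poly_maps_one)
next
  case (Cons Q Qs)
  then have "Q \<in> poly_maps i \<beta>" "(\<lambda>\<alpha>. list_product G (map (\<lambda>Q. Q \<alpha>) Qs)) \<in> poly_maps i \<beta>"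
    by simp_all
  from poly_maps_mult [OF this] show ?case by simp
qed

text \<open>One enumeration of the \<open>d\<close>-tuples from \<open>M\<close> serves all
  \<open>\<alpha> \<subseteq> M\<close>: the factor of \<open>s\<close> is present exactly when
  \<open>set s \<subseteq> \<alpha>\<close>, and is replaced by \<open>\<one>\<close> otherwise. It
  is thus a generator at \<open>set s\<close>, which has at most \<open>d\<close> elements, and
  every coefficient has depth \<open>d\<close>.\<close>

lemma monomial_poly_map:
  assumes u: "u \<in> tuples UNIV d \<rightarrow> carrier G" and r: "linear_order_on (tuples UNIV d) r"
    and Q: "\<And>\<alpha>. \<alpha> \<in> finsets \<Longrightarrow> Q \<alpha> = ordered_product G r u (tuples \<alpha> d)"
    and d: "\<Gamma> d = carrier G"
  shows "Q \<in> poly_maps 0 {}"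
proof -
  have *: "\<exists>x\<in>cubes 0 M. \<forall>\<alpha>\<subseteq>M. Q \<alpha> = x \<alpha>" if M: "finite M" for M
  proof -
    have sub: "tuples M d \<subseteq> tuples UNIV d" by (auto simp: tuples_def)
    obtain xs where xs: "distinct xs" "set xs = tuples M d" "sorted_wrt (\<lambda>s t. (s, t) \<in> r) xs"
      using finite_sorted_enumeration_exists [OF finite_tuples [OF M] r sub] by blast
    have u': "u ` set xs \<subseteq> carrier G"
      using xs sub u by auto
    have "(\<lambda>\<alpha>. if set s \<subseteq> \<alpha> then u s else \<one>) \<in> cubes 0 M" if "s \<in> set xs" for s
    proof (rule cubes.gen)
      show "set s \<subseteq> M" using that xs by (simp add: tuples_def)
      have "card (set s) \<le> d"
        using that xs card_length [of s] by (simp add: tuples_def)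
      moreover have "u s \<in> \<Gamma> d"
        using that u' d by auto
      ultimately show "u s \<in> \<Gamma> (0 + card (set s))"
        using filtration_mono by simp
    qed
    then have x: "(\<lambda>\<alpha>. list_product G (map (\<lambda>s. if set s \<subseteq> \<alpha> then u s else \<one>) xs)) \<in> cubes 0 M"
      by (rule cubes_list_product)
    have "Q \<alpha> = list_product G (map (\<lambda>s. if set s \<subseteq> \<alpha> then u s else \<one>) xs)"
      if "\<alpha> \<subseteq> M" for \<alpha>
    proof -
      have "enumeration r (tuples \<alpha> d) = filter (\<lambda>s. set s \<subseteq> \<alpha>) xs"
      proof (rule enumeration_eqI [OF r])
        show "set (filter (\<lambda>s. set s \<subseteq> \<alpha>) xs) = tuples \<alpha> d"
          using xs that by (auto simp: tuples_def)
      qed (use xs in \<open>auto simp: sorted_wrt_filter\<close>)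
      moreover have "\<alpha> \<in> finsets"
        using that M finite_subset by (auto simp: Fpow_def)
      ultimately show ?thesis
        using Q [of \<alpha>] list_product_filter [OF u'] by (simp add: ordered_product_def)
    qed
    then show ?thesis by (intro bexI [OF _ x]) simp
  qed
  show ?thesis
  proof (rule poly_mapsI)
    fix \<alpha> :: "nat set" assume "finite \<alpha>"
    from * [OF this] show "Q \<alpha> \<in> carrier G" by auto
  next
    fix M :: "nat set" assume "finite M"
    then show "\<exists>x\<in>cubes 0 M. \<forall>\<alpha>\<subseteq>M. Q \<alpha> = x \<alpha>" by (rule *)
  qed
qed

lemma poly_maps_cong:
  assumes "P \<in> poly_maps i \<beta>" "\<And>\<alpha>. finite \<alpha> \<Longrightarrow> Q \<alpha> = P \<alpha>"
  shows "Q \<in> poly_maps i \<beta>"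
proof (rule poly_mapsI)
  fix M :: "nat set" assume M: "finite M" "M \<inter> \<beta> = {}"
  with assms(1) obtain x where x: "x \<in> cubes i M" "\<And>\<alpha>. \<alpha> \<subseteq> M \<Longrightarrow> P \<alpha> = x \<alpha>"
    by (rule poly_mapsE) blast
  then show "\<exists>x\<in>cubes i M. \<forall>\<alpha>\<subseteq>M. Q \<alpha> = x \<alpha>"
    using assms(2) finite_subset [OF _ M(1)] by (intro bexI [OF _ x(1)]) simp
qed (use assms poly_maps_closed in auto)

end

text \<open>The filtration repeats each term of the lower central series \<open>d\<close> times, so that it gives every
  element of the group, viewed as a coefficient of a monomial of degree at most \<open>d\<close>, sufficient depth.\<close>

lemma (in nilpotent_group) ex_group_filtration:
  assumes "d > 0"
  obtains \<Gamma> N where "group_filtration G \<Gamma> N" "\<And>j. j \<le> d \<Longrightarrow> \<Gamma> j = carrier G"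
proof -
  obtain n where n: "lower_central G n = {\<one>}"
    using lower_central_trivial by blast
  \<comment> \<open>The index \<open>n * d + 1\<close> gives exactly the trivial term
    \<open>n\<close>.\<close>
  have "group_filtration G (\<lambda>j. lower_central G ((j - 1) div d)) (n * d + 1)"
  proof (intro group_filtration.intro group_filtration_axioms.intro)
    show "group G" by (rule is_group)
    fix i j :: nat
    show "subgroup (lower_central G ((i - 1) div d)) G"
      by (rule lower_central_subgroup)
    show "lower_central G ((j - 1) div d) \<subseteq> lower_central G ((i - 1) div d)" if "i \<le> j"
      using that by (intro lower_central_antimono div_le_mono) simp
    fix x y assume x: "x \<in> lower_central G ((i - 1) div d)" and y: "y \<in> lower_central G ((j - 1) div d)"
    show "commutator x y \<in> lower_central G ((i + j - 1) div d)"
    \<comment> \<open>Truncated subtraction puts the indices 0 and 1 at the same term. If one index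
      is 0, the target is the term of the other and normality suffices.\<close>
    proof (cases "i = 0 \<or> j = 0")
      case False
      \<comment> \<open>The quotient of \<open>(i - 1) + (j - 1) + 1\<close> by \<open>d\<close>
        exceeds the sum of the two quotients by at most one, which is the gain in
        \<open>commutator_lower_central\<close>.\<close>
      have "k < Suc (k div d) * d" for k
        using dividend_less_div_times [OF assms, of k] by simp
      from this [of "i - 1"] this [of "j - 1"]
      have "i + j - 1 < Suc ((i - 1) div d) * d + Suc ((j - 1) div d) * d"
        using False by linarith
      also have "\<dots> = Suc (Suc ((i - 1) div d + (j - 1) div d)) * d"
        by (simp add: algebra_simps)
      finally have "i + j - 1 < Suc (Suc ((i - 1) div d + (j - 1) div d)) * d" .
      then have "(i + j - 1) div d \<le> Suc ((i - 1) div d + (j - 1) div d)"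
        using assms by (metis less_mult_imp_div_less less_Suc_eq_le)
      then show ?thesis
        using commutator_lower_central [OF x y] lower_central_antimono by blast
    next
      case True
      then have "commutator x y \<in> lower_central G ((if i = 0 then j - 1 else i - 1) div d)"
      proof (cases "i = 0")
        case True
        have x': "x \<in> carrier G" using x lower_central_mem by blast
        have "x \<otimes> y \<otimes> inv x \<otimes> inv y \<in> lower_central G ((j - 1) div d)"
          by (rule subgroup.m_closed [OF lower_central_subgroup lower_central_conj [OF y x']
                subgroup.m_inv_closed [OF lower_central_subgroup y]])
        then show ?thesis using True by (simp add: commutator_def)
      next
        case False
        with True have y': "y \<in> carrier G" using y by simp
        have "x \<otimes> (y \<otimes> inv x \<otimes> inv y) \<in> lower_central G ((i - 1) div d)"
          by (rule subgroup.m_closed [OF lower_central_subgroup x lower_central_conj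
                [OF subgroup.m_inv_closed [OF lower_central_subgroup x] y']])
        then show ?thesis
          using False y' lower_central_mem [OF x] by (simp add: commutator_def m_assoc)
      qed
      then show ?thesis using True by (auto split: if_splits)
    qed
  qed (use assms n in auto)
  moreover have "lower_central G ((j - 1) div d) = carrier G" if "j \<le> d" for j
    using that assms by (cases j) auto
  ultimately show ?thesis by (rule that)
qed

subsection \<open>Ultrafilters and minimal left ideals\<close>

lemma ultrafiltersD:
  assumes "p \<in> ultrafilters S"
  shows "A \<in> p \<Longrightarrow> A \<subseteq> S" "S \<in> p" "{} \<notin> p"
    "A \<in> p \<Longrightarrow> B \<in> p \<Longrightarrow> A \<inter> B \<in> p"
    "A \<in> p \<Longrightarrow> A \<subseteq> B \<Longrightarrow> B \<subseteq> S \<Longrightarrow> B \<in> p"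
    "A \<subseteq> S \<Longrightarrow> A \<notin> p \<Longrightarrow> S - A \<in> p"
  using assms unfolding ultrafilters_def by blast+

lemma ultrafilters_finite_Inter:
  assumes "p \<in> ultrafilters S" "finite I" "\<And>i. i \<in> I \<Longrightarrow> A i \<in> p"
  shows "S \<inter> (\<Inter>i\<in>I. A i) \<in> p"
  using assms(2,3)
proof (induction rule: finite_induct)
  case empty
  then show ?case using ultrafiltersD(2) [OF assms(1)] by simp
next
  case (insert i I)
  then have "A i \<in> p" "S \<inter> (\<Inter>i\<in>I. A i) \<in> p" by simp_all
  from ultrafiltersD(4) [OF assms(1) this] show ?case
    by (simp add: Int_ac)
qed

lemma ultrafilters_Diff_iff:
  assumes "p \<in> ultrafilters S" "A \<subseteq> S"
  shows "S - A \<in> p \<longleftrightarrow> A \<notin> p"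
  using ultrafiltersD(3,4,6) [OF assms(1)] assms(2) by (metis Diff_disjoint)

lemma ultrafilters_finite_Union:
  assumes p: "p \<in> ultrafilters S" and I: "finite I" "\<And>i. i \<in> I \<Longrightarrow> A i \<subseteq> S" "S \<subseteq> (\<Union>i\<in>I. A i)"
  shows "\<exists>i\<in>I. A i \<in> p"
proof (rule ccontr)
  assume "\<not> (\<exists>i\<in>I. A i \<in> p)"
  then have "S \<inter> (\<Inter>i\<in>I. S - A i) \<in> p"
    using I ultrafiltersD(6) [OF p] by (intro ultrafilters_finite_Inter [OF p]) auto
  moreover have "S \<inter> (\<Inter>i\<in>I. S - A i) = {}"
    using I(3) by auto
  ultimately show False
    using ultrafiltersD(3) [OF p] by simp
qed

section \<open>Compactness: extension of families to ultrafilters\<close>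

definition fip :: "'x set \<Rightarrow> 'x set set \<Rightarrow> bool" where
  "fip S F \<longleftrightarrow> F \<subseteq> Pow S \<and> (\<forall>E. finite E \<and> E \<subseteq> F \<longrightarrow> S \<inter> \<Inter>E \<noteq> {})"

lemma fip_Union_chain:
  assumes "C \<noteq> {}" "subset.chain {F. fip S F} C"
  shows "fip S (\<Union>C)"
  unfolding fip_def
proof (intro conjI allI impI)
  have C: "fip S F" if "F \<in> C" for F
    using assms(2) that by (auto simp: subset_chain_def)
  then show "\<Union>C \<subseteq> Pow S"
    by (auto simp: fip_def)
  fix E assume "finite E \<and> E \<subseteq> \<Union>C"
  then obtain F where "F \<in> C" "finite E" "E \<subseteq> F"
    using finite_subset_Union_chain [of E C] assms by metis
  then show "S \<inter> \<Inter>E \<noteq> {}"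
    using C [of F] by (auto simp: fip_def)
qed

text \<open>Zorn's lemma gives a maximal family above \<open>F\<close> with the finite intersection
  property, and maximality makes it an ultrafilter.\<close>

lemma ultrafilters_extend:
  assumes F: "fip S F"
  shows "\<exists>p\<in>ultrafilters S. F \<subseteq> p"
proof -
  have "\<exists>p\<in>{p. fip S p \<and> F \<subseteq> p}. \<forall>E\<in>{p. fip S p \<and> F \<subseteq> p}. p \<subseteq> E \<longrightarrow> E = p"
  proof (rule subset_Zorn_nonempty)
    show "\<Union>C \<in> {p. fip S p \<and> F \<subseteq> p}" if C: "C \<noteq> {}" "subset.chain {p. fip S p \<and> F \<subseteq> p} C" for C
      using fip_Union_chain [OF C(1), of S] C by (auto simp: subset_chain_def)
  qed (use F in auto)
  then obtain p where p: "fip S p" "F \<subseteq> p" and max: "\<And>E. fip S E \<Longrightarrow> p \<subseteq> E \<Longrightarrow> E = p"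
    by auto
  have pS: "A \<subseteq> S" if "A \<in> p" for A
    using p(1) that by (auto simp: fip_def)
  have fin: "S \<inter> \<Inter>E \<noteq> {}" if "finite E" "E \<subseteq> p" for E
    using p(1) that by (auto simp: fip_def)
  \<comment> \<open>Maximality: a set compatible with all finite intersections of members of
    \<open>p\<close> is itself a member. Most ultrafilter axioms are instances of this.\<close>
  have mem: "B \<in> p" if B: "B \<subseteq> S" "\<And>E. finite E \<Longrightarrow> E \<subseteq> p \<Longrightarrow> S \<inter> \<Inter>E \<inter> B \<noteq> {}" for B
  proof -
    have "fip S (insert B p)"
      unfolding fip_def
    proof (intro conjI allI impI)
      show "insert B p \<subseteq> Pow S" using B(1) pS by auto
      fix E assume E: "finite E \<and> E \<subseteq> insert B p"
      then have "S \<inter> \<Inter>(E - {B}) \<inter> B \<noteq> {}"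
        by (intro B(2)) auto
      then show "S \<inter> \<Inter>E \<noteq> {}" by auto
    qed
    then show ?thesis using max by blast
  qed
  have "p \<in> ultrafilters S"
    unfolding ultrafilters_def
  proof (intro CollectI conjI ballI allI impI)
    show "p \<subseteq> Pow S" using pS by auto
    show "S \<in> p" using fin by (intro mem) auto
    show "{} \<notin> p" using fin [of "{{}}"] by auto
    show "A \<inter> B \<in> p" if "A \<in> p" "B \<in> p" for A B
    proof (rule mem)
      show "A \<inter> B \<subseteq> S" using pS that by auto
      fix E assume "finite E" "E \<subseteq> p"
      then show "S \<inter> \<Inter>E \<inter> (A \<inter> B) \<noteq> {}"
        using fin [of "insert A (insert B E)"] that by auto
    qed
    show "B \<in> p" if "A \<in> p" "A \<subseteq> B \<and> B \<subseteq> S" for A B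
    proof (rule mem)
      show "B \<subseteq> S" using that by auto
      fix E assume "finite E" "E \<subseteq> p"
      then show "S \<inter> \<Inter>E \<inter> B \<noteq> {}"
        using fin [of "insert A E"] that by auto
    qed
    show "A \<in> p \<or> S - A \<in> p" if "A \<subseteq> S" for A
    proof (rule disjCI)
      assume "S - A \<notin> p"
      then obtain E where E: "finite E" "E \<subseteq> p" "S \<inter> \<Inter>E \<inter> (S - A) = {}"
        using mem [of "S - A"] by auto
      show "A \<in> p"
      proof (rule mem [OF that])
        fix Y assume "finite Y" "Y \<subseteq> p"
        then have "S \<inter> \<Inter>(E \<union> Y) \<noteq> {}"
          using E by (intro fin) auto
        then show "S \<inter> \<Inter>Y \<inter> A \<noteq> {}"
          using E(3) by blast
      qed
    qed
  qed
  then show ?thesis using p(2) by blast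
qed

context group
begin

lemma left_quotient_subset: "left_quotient G x A \<subseteq> carrier G"
  by (auto simp: left_quotient_def)

lemma left_quotient_carrier: "x \<in> carrier G \<Longrightarrow> left_quotient G x (carrier G) = carrier G"
  by (auto simp: left_quotient_def)

lemma left_quotient_one: "A \<subseteq> carrier G \<Longrightarrow> left_quotient G \<one> A = A"
  by (auto simp: left_quotient_def)

lemma left_quotient_Diff:
  "x \<in> carrier G \<Longrightarrow> left_quotient G x (carrier G - A) = carrier G - left_quotient G x A"
  by (auto simp: left_quotient_def)

lemma left_quotient_Int:
  "left_quotient G x (A \<inter> B) = left_quotient G x A \<inter> left_quotient G x B"
  by (auto simp: left_quotient_def)

lemma left_quotient_mono: "A \<subseteq> B \<Longrightarrow> left_quotient G x A \<subseteq> left_quotient G x B"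
  by (auto simp: left_quotient_def)

lemma left_quotient_empty [simp]: "left_quotient G x {} = {}"
  by (auto simp: left_quotient_def)

lemma left_quotient_left_quotient:
  "x \<in> carrier G \<Longrightarrow> y \<in> carrier G \<Longrightarrow>
    left_quotient G y (left_quotient G x A) = left_quotient G (x \<otimes> y) A"
  by (auto simp: left_quotient_def m_assoc)

lemma beta_mult_mem_iff:
  "A \<in> beta_mult G p q \<longleftrightarrow> A \<subseteq> carrier G \<and> {x \<in> carrier G. left_quotient G x A \<in> q} \<in> p"
  by (simp add: beta_mult_def)

text \<open>\<open>T\<close> respects inclusions, intersections and complements, because left
  quotients do and \<open>q\<close> is an ultrafilter; the product is the preimage of
  \<open>p\<close> under \<open>T\<close>.\<close>

lemma beta_mult_closed:
  assumes p: "p \<in> ultrafilters (carrier G)" and q: "q \<in> ultrafilters (carrier G)"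
  shows "beta_mult G p q \<in> ultrafilters (carrier G)"
proof -
  define T where "T A = {x \<in> carrier G. left_quotient G x A \<in> q}" for A
  have mem: "A \<in> beta_mult G p q \<longleftrightarrow> A \<subseteq> carrier G \<and> T A \<in> p" for A
    by (simp add: beta_mult_mem_iff T_def)
  have T: "T A \<subseteq> carrier G" for A by (auto simp: T_def)
  have T_carrier: "T (carrier G) = carrier G"
    using ultrafiltersD(2) [OF q] by (auto simp: T_def left_quotient_carrier)
  have T_empty: "T {} = {}"
    using ultrafiltersD(3) [OF q] by (auto simp: T_def)
  have T_Int: "T A \<inter> T B \<subseteq> T (A \<inter> B)" for A B
    using ultrafiltersD(4) [OF q] by (auto simp: T_def left_quotient_Int)
  have T_mono: "T A \<subseteq> T B" if "A \<subseteq> B" for A B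
    using ultrafiltersD(5) [OF q _ left_quotient_mono [OF that] left_quotient_subset]
    by (auto simp: T_def)
  have T_Diff: "T (carrier G - A) = carrier G - T A" for A
    using ultrafilters_Diff_iff [OF q left_quotient_subset] by (auto simp: T_def left_quotient_Diff)
  show ?thesis
    unfolding ultrafilters_def
  proof (intro CollectI conjI ballI allI impI)
    show "beta_mult G p q \<subseteq> Pow (carrier G)" using mem by auto
    show "carrier G \<in> beta_mult G p q" using mem T_carrier ultrafiltersD(2) [OF p] by auto
    show "{} \<notin> beta_mult G p q" using mem T_empty ultrafiltersD(3) [OF p] by auto
    show "A \<inter> B \<in> beta_mult G p q" if "A \<in> beta_mult G p q" "B \<in> beta_mult G p q" for A B
      using that mem ultrafiltersD(5) [OF p ultrafiltersD(4) [OF p] T_Int T] by auto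
    show "B \<in> beta_mult G p q" if "A \<in> beta_mult G p q" "A \<subseteq> B \<and> B \<subseteq> carrier G" for A B
      using that mem ultrafiltersD(5) [OF p _ T_mono T] by auto
    show "A \<in> beta_mult G p q \<or> carrier G - A \<in> beta_mult G p q" if "A \<subseteq> carrier G" for A
      using that ultrafiltersD(6) [OF p T, of A] by (simp add: mem T_Diff) blast
  qed
qed

lemma left_quotient_Collect:
  "x \<in> carrier G \<Longrightarrow> left_quotient G x {y \<in> carrier G. P y} = {y \<in> carrier G. P (x \<otimes> y)}"
  by (auto simp: left_quotient_def)

lemma beta_mult_assoc:
  "beta_mult G (beta_mult G p q) r = beta_mult G p (beta_mult G q r)"
proof -
  have "A \<in> beta_mult G (beta_mult G p q) r \<longleftrightarrow> A \<in> beta_mult G p (beta_mult G q r)" for A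
    by (simp add: beta_mult_mem_iff left_quotient_subset left_quotient_Collect
        left_quotient_left_quotient Collect_restrict cong: conj_cong)
  then show ?thesis by blast
qed

lemma principal_ultrafilter: "x \<in> S \<Longrightarrow> {A. A \<subseteq> S \<and> x \<in> A} \<in> ultrafilters S"
  by (auto simp: ultrafilters_def)

end

section \<open>Minimal left ideals as minimal spaces for the group action\<close>

locale minimal_left_ideal_action = group G for G :: "('a, 'b) monoid_scheme" (structure) +
  fixes L :: "'a set set set"
  assumes L_minimal: "minimal_left_ideal G L"
begin

lemma L_ultrafilter: "p \<in> L \<Longrightarrow> p \<in> ultrafilters (carrier G)"
  using L_minimal by (auto simp: minimal_left_ideal_def beta_left_ideal_def)

lemma L_mult: "p \<in> ultrafilters (carrier G) \<Longrightarrow> q \<in> L \<Longrightarrow> beta_mult G p q \<in> L"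
  using L_minimal by (auto simp: minimal_left_ideal_def beta_left_ideal_def)

text \<open>The left multiples of \<open>q\<close> form a left ideal inside \<open>L\<close>, which
  by minimality is all of \<open>L\<close>.\<close>

lemma L_generated:
  assumes q: "q \<in> L" and p: "p \<in> L"
  obtains r where "r \<in> ultrafilters (carrier G)" "p = beta_mult G r q"
proof -
  let ?I = "(\<lambda>r. beta_mult G r q) ` ultrafilters (carrier G)"
  have "beta_left_ideal G ?I"
    unfolding beta_left_ideal_def
  proof (intro conjI ballI)
    show "?I \<noteq> {}"
      using L_ultrafilter [OF q] by auto
    show "?I \<subseteq> ultrafilters (carrier G)"
      using beta_mult_closed L_ultrafilter [OF q] by auto
    fix s t assume "s \<in> ultrafilters (carrier G)" "t \<in> ?I"
    then show "beta_mult G s t \<in> ?I"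
      using beta_mult_closed by (auto simp: beta_mult_assoc [symmetric])
  qed
  moreover have "?I \<subseteq> L"
    using L_mult q by auto
  ultimately have "?I = L"
    using L_minimal by (auto simp: minimal_left_ideal_def)
  then show ?thesis
    using p that by auto
qed

text \<open>The closure of \<open>A\<close> traces a nonempty open set on \<open>L\<close>.\<close>

definition meets :: "'a set \<Rightarrow> bool" where
  "meets A \<longleftrightarrow> (\<exists>p\<in>L. A \<in> p)"

lemma meets_subset: "meets A \<Longrightarrow> A \<subseteq> carrier G"
  using L_ultrafilter ultrafiltersD(1) by (fastforce simp: meets_def)

lemma meets_mono: "meets A \<Longrightarrow> A \<subseteq> B \<Longrightarrow> B \<subseteq> carrier G \<Longrightarrow> meets B"
  using L_ultrafilter ultrafiltersD(5) unfolding meets_def by metis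

text \<open>Left multiplication by the principal ultrafilter at \<open>inv x\<close> stays in
  \<open>L\<close> and carries a witness for \<open>A\<close> to one for the left quotient.\<close>

lemma meets_left_quotient:
  assumes A: "meets A" and x: "x \<in> carrier G"
  shows "meets (left_quotient G x A)"
proof -
  obtain p where p: "p \<in> L" "A \<in> p" using A by (auto simp: meets_def)
  let ?e = "{B. B \<subseteq> carrier G \<and> inv x \<in> B}"
  have "left_quotient G (inv x) (left_quotient G x A) = A"
    using x meets_subset [OF A] by (simp add: left_quotient_left_quotient left_quotient_one)
  then have "left_quotient G x A \<in> beta_mult G ?e p"
    using p x by (auto simp: beta_mult_mem_iff left_quotient_subset)
  moreover have "beta_mult G ?e p \<in> L"
    using x p(1) by (intro L_mult principal_ultrafilter) simp_all
  ultimately show ?thesis by (auto simp: meets_def)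
qed

text \<open>If no finitely many translates of \<open>U\<close> covered \<open>L\<close>, compactness
  would yield \<open>r\<close> such that no translate belongs to the product of \<open>r\<close> and
  \<open>p\<close>. But minimality recovers \<open>p\<close> from this product by a left
  multiplication, and \<open>U \<in> p\<close> then yields such a translate.\<close>

lemma meets_cover:
  assumes U: "meets U"
  obtains F where "finite F" "F \<subseteq> carrier G"
    "\<And>V. meets V \<Longrightarrow> \<exists>x\<in>F. meets (V \<inter> left_quotient G x U)"
proof -
  obtain p where p: "p \<in> L" "U \<in> p" using U by (auto simp: meets_def)
  \<comment> \<open>A translate of \<open>U\<close> lies in the product of \<open>r\<close> and
    \<open>p\<close> exactly when that of \<open>T\<close> lies in \<open>r\<close>; this moves the
    covering question from \<open>L\<close> to all ultrafilters.\<close>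
  define T where "T = {y \<in> carrier G. left_quotient G y U \<in> p}"
  have T: "T \<subseteq> carrier G" by (auto simp: T_def)
  have mult_mem: "left_quotient G x U \<in> beta_mult G r p \<longleftrightarrow> left_quotient G x T \<in> r"
    if "x \<in> carrier G" for x r
  proof -
    have "{y \<in> carrier G. left_quotient G y (left_quotient G x U) \<in> p} = left_quotient G x T"
      using that by (simp add: T_def left_quotient_Collect left_quotient_left_quotient cong: conj_cong)
    then show ?thesis
      by (simp add: beta_mult_mem_iff left_quotient_subset)
  qed
  have "\<not> fip (carrier G) ((\<lambda>x. carrier G - left_quotient G x T) ` carrier G)"
  proof
    assume "fip (carrier G) ((\<lambda>x. carrier G - left_quotient G x T) ` carrier G)"
    from ultrafilters_extend [OF this] obtain r where r: "r \<in> ultrafilters (carrier G)"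
      and r_sub: "(\<lambda>x. carrier G - left_quotient G x T) ` carrier G \<subseteq> r" by blast
    have r': "carrier G - left_quotient G x T \<in> r" if "x \<in> carrier G" for x
      using r_sub that by blast
    have "beta_mult G r p \<in> L" using r p by (intro L_mult)
    from L_generated [OF this p(1)] obtain s
      where s: "s \<in> ultrafilters (carrier G)" "p = beta_mult G s (beta_mult G r p)" .
    then have "{x \<in> carrier G. left_quotient G x U \<in> beta_mult G r p} \<in> s"
      using p(2) beta_mult_mem_iff [of U s "beta_mult G r p"] by simp
    then obtain x where x: "x \<in> carrier G" "left_quotient G x U \<in> beta_mult G r p"
      using ultrafiltersD(3) [OF s(1)] by (metis (no_types, lifting) empty_Collect_eq)
    then have "left_quotient G x T \<in> r" using mult_mem by simp
    then show False
      using r' [OF x(1)] ultrafilters_Diff_iff [OF r left_quotient_subset] by simp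
  qed
  then obtain E where E: "finite E" "E \<subseteq> (\<lambda>x. carrier G - left_quotient G x T) ` carrier G"
    "carrier G \<inter> \<Inter>E = {}"
    by (auto simp: fip_def)
  then obtain F where F: "F \<subseteq> carrier G" "finite F" "E = (\<lambda>x. carrier G - left_quotient G x T) ` F"
    by (metis finite_subset_image)
  have "\<exists>x\<in>F. meets (V \<inter> left_quotient G x U)" if V: "meets V" for V
  proof -
    obtain q where q: "q \<in> L" "V \<in> q" using V by (auto simp: meets_def)
    obtain r where r: "r \<in> ultrafilters (carrier G)" "q = beta_mult G r p"
      using L_generated p(1) q(1) by metis
    have "\<exists>x\<in>F. left_quotient G x T \<in> r"
      using F E(3) by (intro ultrafilters_finite_Union [OF r(1)]) (auto simp: left_quotient_subset)
    then obtain x where x: "x \<in> F" "left_quotient G x T \<in> r" by blast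
    then have "left_quotient G x U \<in> q"
      using mult_mem F r(2) by auto
    then have "V \<inter> left_quotient G x U \<in> q"
      using q ultrafiltersD(4) [OF L_ultrafilter] by blast
    then show ?thesis using x q by (auto simp: meets_def)
  qed
  then show ?thesis using F that by blast
qed

end

subsection \<open>PET induction\<close>

definition disjoint_shift :: "nat set set \<Rightarrow> nat set \<Rightarrow> nat set set" where
  "disjoint_shift D \<alpha> = {\<beta> \<in> finsets. \<alpha> \<inter> \<beta> = {} \<and> \<alpha> \<union> \<beta> \<in> D}"

text \<open>The starred set from the ultrafilter proof of Hindman's theorem: each member stays
  inside it when united with \<open>v\<close>-almost every disjoint set.\<close>

definition recurrent_part :: "nat set set set \<Rightarrow> nat set set \<Rightarrow> nat set set" where
  "recurrent_part v D = {\<alpha> \<in> D. disjoint_shift D \<alpha> \<in> v}"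

locale idempotent_ultrafilter =
  fixes v :: "nat set set set"
  assumes v_adequate: "v \<in> adequate_ultrafilters"
    and v_idempotent: "v = uplus v v"
begin

lemma v_ultrafilter: "v \<in> ultrafilters finsets"
  using v_adequate by (simp add: adequate_ultrafilters_def)

lemma v_avoids: "finite \<beta> \<Longrightarrow> {\<alpha> \<in> finsets. \<alpha> \<inter> \<beta> = {}} \<in> v"
  using v_adequate by (simp add: adequate_ultrafilters_def Fpow_def)

lemma recurrent_part_mem:
  assumes D: "D \<in> v"
  shows "recurrent_part v D \<in> v"
proof -
  have "{\<alpha> \<in> finsets. disjoint_shift D \<alpha> \<in> v} \<in> v"
    using D v_idempotent by (auto simp: uplus_def disjoint_shift_def)
  from ultrafiltersD(4) [OF v_ultrafilter D this]
  have "D \<inter> {\<alpha> \<in> finsets. disjoint_shift D \<alpha> \<in> v} \<in> v" .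
  moreover have "D \<inter> {\<alpha> \<in> finsets. disjoint_shift D \<alpha> \<in> v} = recurrent_part v D"
    using ultrafiltersD(1) [OF v_ultrafilter D] by (auto simp: recurrent_part_def)
  ultimately show ?thesis by simp
qed

text \<open>Apply \<open>recurrent_part_mem\<close> to the shift of \<open>D\<close> by
  \<open>\<alpha>\<close>: shifting once more by \<open>\<beta>\<close> lands in the shift of
  \<open>D\<close> by \<open>\<alpha> \<union> \<beta>\<close>, so this union is again
  recurrent.\<close>

lemma recurrent_part_shift:
  assumes "\<alpha> \<in> recurrent_part v D"
  shows "disjoint_shift (recurrent_part v D) \<alpha> \<in> v"
proof -
  let ?S = "disjoint_shift D \<alpha>"
  have rS: "recurrent_part v ?S \<in> v"
    using assms by (intro recurrent_part_mem) (simp add: recurrent_part_def)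
  have "recurrent_part v ?S \<subseteq> disjoint_shift (recurrent_part v D) \<alpha>"
  proof
    fix \<beta> assume "\<beta> \<in> recurrent_part v ?S"
    then have \<beta>: "\<beta> \<in> finsets" "\<alpha> \<inter> \<beta> = {}" "\<alpha> \<union> \<beta> \<in> D" and S: "disjoint_shift ?S \<beta> \<in> v"
      by (auto simp: recurrent_part_def disjoint_shift_def)
    have "disjoint_shift ?S \<beta> \<subseteq> disjoint_shift D (\<alpha> \<union> \<beta>)"
      by (auto simp: disjoint_shift_def Un_assoc)
    then have "disjoint_shift D (\<alpha> \<union> \<beta>) \<in> v"
      by (intro ultrafiltersD(5) [OF v_ultrafilter S]) (auto simp: disjoint_shift_def)
    with \<beta> show "\<beta> \<in> disjoint_shift (recurrent_part v D) \<alpha>"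
      by (simp add: disjoint_shift_def recurrent_part_def)
  qed
  moreover have "disjoint_shift (recurrent_part v D) \<alpha> \<subseteq> finsets"
    by (auto simp: disjoint_shift_def)
  ultimately show ?thesis
    by (rule ultrafiltersD(5) [OF v_ultrafilter rS])
qed

end

section \<open>Systems of polynomial maps and their weights\<close>

locale polynomial_recurrence =
  group_filtration G \<Gamma> N + minimal_left_ideal_action G L + idempotent_ultrafilter v
  for G :: "('a, 'b) monoid_scheme" (structure) and \<Gamma> N L v
begin

definition return_set :: "(nat set \<Rightarrow> 'a) set \<Rightarrow> 'a set \<Rightarrow> nat set \<Rightarrow> 'a set" where
  "return_set R U \<alpha> = {y \<in> U. \<forall>P\<in>R. P \<alpha> \<otimes> y \<in> U}"

text \<open>A pair \<open>(i, c)\<close> stands for the class of \<open>c\<close> in level \<open>i\<close> modulo level \<open>i + 1\<close>. A finite system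
  is measured by the multiset of levels of the classes it occupies; maps of level \<open>N\<close> are eventually
  trivial and do not count.\<close>

definition in_class :: "nat set \<Rightarrow> nat \<times> (nat set \<Rightarrow> 'a) \<Rightarrow> (nat set \<Rightarrow> 'a) \<Rightarrow> bool" where
  "in_class B = (\<lambda>(i, c) P. P \<in> poly_maps i B \<and> (\<lambda>\<alpha>. P \<alpha> \<otimes> inv (c \<alpha>)) \<in> poly_maps (Suc i) B)"

definition classes_ok :: "nat set \<Rightarrow> (nat \<times> (nat set \<Rightarrow> 'a)) multiset \<Rightarrow> bool" where
  "classes_ok B M \<longleftrightarrow> (\<forall>(i, c)\<in>#M. i < N \<and> c \<in> poly_maps i B \<and> c {} = \<one>)"

text \<open>The multiset is only an upper bound for the classes in \<open>R\<close>; it may contain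
  unoccupied classes or several names of one class.\<close>

definition dominated ::
    "nat set \<Rightarrow> (nat \<times> (nat set \<Rightarrow> 'a)) multiset \<Rightarrow> (nat set \<Rightarrow> 'a) set \<Rightarrow> bool" where
  "dominated B M R \<longleftrightarrow> (\<forall>P\<in>R. P {} = \<one> \<and> (\<exists>k\<in>#M. in_class B k P))"

text \<open>Levels are reversed so that rising in level is a decrease; the multiset order then
  allows one class to be traded for any finite number of classes of higher level.\<close>

definition weight :: "(nat \<times> (nat set \<Rightarrow> 'a)) multiset \<Rightarrow> nat multiset" where
  "weight M = image_mset (\<lambda>(i, c). N - i) M"

text \<open>Conjugation changes \<open>P\<close> by the factor
  \<open>commutator (inv x) (P \<alpha>)\<close>, which is one level higher, so the class is
  kept.\<close>

lemma dominated_conj: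
  assumes "classes_ok B M" "dominated B M R" and F: "F \<subseteq> carrier G"
  shows "dominated B M {\<lambda>\<alpha>. inv x \<otimes> P \<alpha> \<otimes> x | x P. x \<in> F \<and> P \<in> R}"
  unfolding dominated_def
proof
  fix Q assume "Q \<in> {\<lambda>\<alpha>. inv x \<otimes> P \<alpha> \<otimes> x | x P. x \<in> F \<and> P \<in> R}"
  then obtain x P where Q: "Q = (\<lambda>\<alpha>. inv x \<otimes> P \<alpha> \<otimes> x)" and x: "x \<in> carrier G" and P: "P \<in> R"
    using F by auto
  obtain i c where ic: "(i, c) \<in># M" "P \<in> poly_maps i B"
      "(\<lambda>\<alpha>. P \<alpha> \<otimes> inv (c \<alpha>)) \<in> poly_maps (Suc i) B" and P0: "P {} = \<one>"
    using assms(2) P by (auto simp: dominated_def in_class_def)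
  have c: "c \<in> poly_maps i B"
    using assms(1) ic(1) by (auto simp: classes_ok_def)
  have comm: "(\<lambda>\<alpha>. commutator (inv x) (P \<alpha>)) \<in> poly_maps (Suc i) B"
    using x by (intro poly_maps_commutator_const [OF ic(2)]) simp
  have Q_eq: "Q \<alpha> = commutator (inv x) (P \<alpha>) \<otimes> P \<alpha>" if "finite \<alpha>" for \<alpha>
    using x poly_maps_closed [OF ic(2) that] by (simp add: Q commutator_def group_normalize)
  have "Q \<in> poly_maps i B"
  proof (rule poly_maps_cong)
    show "(\<lambda>\<alpha>. commutator (inv x) (P \<alpha>) \<otimes> P \<alpha>) \<in> poly_maps i B"
      by (rule poly_maps_mult [OF poly_maps_antimono [OF comm] ic(2)]) simp
  qed (rule Q_eq)
  moreover have "(\<lambda>\<alpha>. Q \<alpha> \<otimes> inv (c \<alpha>)) \<in> poly_maps (Suc i) B"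
  proof (rule poly_maps_cong [OF poly_maps_mult [OF comm ic(3)]])
    fix \<alpha> :: "nat set" assume \<alpha>: "finite \<alpha>"
    then show "Q \<alpha> \<otimes> inv (c \<alpha>) = commutator (inv x) (P \<alpha>) \<otimes> (P \<alpha> \<otimes> inv (c \<alpha>))"
      using Q_eq [OF \<alpha>] x poly_maps_closed [OF ic(2) \<alpha>] poly_maps_closed [OF c \<alpha>]
      by (simp add: m_assoc)
  qed
  ultimately have "in_class B (i, c) Q" by (simp add: in_class_def)
  moreover have "Q {} = \<one>" using x P0 Q by simp
  ultimately show "Q {} = \<one> \<and> (\<exists>k\<in>#M. in_class B k Q)"
    using ic(1) by blast
qed

text \<open>At time \<open>\<alpha>\<close> the map belonging to \<open>P\<close> and
  \<open>\<beta>\<close> sends \<open>c \<alpha> \<otimes> y\<close> to \<open>inv (P \<beta>)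
  \<otimes> P (\<beta> \<union> \<alpha>) \<otimes> y\<close>. If the latter lies in a set
  \<open>V\<close>, then \<open>P (\<beta> \<union> \<alpha>)\<close> moves \<open>y\<close> into
  the image of \<open>V\<close> under \<open>P \<beta>\<close>.\<close>

definition derived_system ::
    "(nat set \<Rightarrow> 'a) \<Rightarrow> nat set set \<Rightarrow> (nat set \<Rightarrow> 'a) set \<Rightarrow> (nat set \<Rightarrow> 'a) set" where
  "derived_system c E R = (\<lambda>(P, \<beta>) \<alpha>. inv (P \<beta>) \<otimes> P (\<beta> \<union> \<alpha>) \<otimes> inv (c \<alpha>)) ` (R \<times> E)"

text \<open>Each derived map is a difference \<open>\<Delta>\<close>, one level above
  \<open>P\<close>, times \<open>P \<alpha> \<otimes> inv (c \<alpha>)\<close>. Maps from the class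
  of \<open>c\<close> therefore rise to level \<open>Suc i\<close>, while a map from another class
  \<open>(j, c')\<close> moves to the class of \<open>c' \<alpha> \<otimes> inv (c \<alpha>)\<close>
  at the same level \<open>j\<close>. Maximality of \<open>i\<close> ensures that \<open>c\<close>
  belongs to level \<open>j\<close>.\<close>

lemma derived_system_dominated:
  assumes ok: "classes_ok B M" and dom: "dominated B M R" and fin: "finite B" "finite R" "finite E"
    and E: "\<And>\<beta>. \<beta> \<in> E \<Longrightarrow> finite \<beta> \<and> \<beta> \<inter> B = {}"
    and c: "(i, c) \<in># M" and max: "\<And>j c'. (j, c') \<in># M \<Longrightarrow> j \<le> i"
  obtains B' M' where "finite B'" "classes_ok B' M'" "weight M' < weight M"
    "dominated B' M' {Q \<in> derived_system c E R. Q \<notin> poly_maps N B'}"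
    "\<forall>Q\<in>derived_system c E R. Q {} = \<one>"
proof -
  \<comment> \<open>Differences in direction \<open>\<beta>\<close> are known to be polynomial only
    off \<open>\<beta>\<close>, hence the enlarged set.\<close>
  define B' where "B' = B \<union> \<Union>E"
  define R' where "R' = {Q \<in> derived_system c E R. Q \<in> poly_maps (Suc i) B' \<and> Suc i < N}"
  \<comment> \<open>\<open>M1\<close> holds the old classes other than the chosen one, divided by
    \<open>c\<close>; \<open>M2\<close> lets every derived map of level \<open>Suc i\<close>
    represent its own class.\<close>
  define M1 where "M1 = image_mset (\<lambda>(j, c'). (j, \<lambda>\<alpha>. c' \<alpha> \<otimes> inv (c \<alpha>))) (M - {#(i, c)#})"
  define M2 where "M2 = image_mset (Pair (Suc i)) (mset_set R')"
  have fin_derived: "finite (derived_system c E R)"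
    using fin by (simp add: derived_system_def)
  then have fin_R': "finite R'" by (simp add: R'_def)
  have B': "B \<subseteq> B'" by (simp add: B'_def)
  have c_props: "i < N" "c \<in> poly_maps i B'" "c {} = \<one>"
    using ok c poly_maps_mono [OF _ B'] by (auto simp: classes_ok_def)
  have c_inv: "(\<lambda>\<alpha>. inv (c \<alpha>)) \<in> poly_maps j B'" if "j \<le> i" for j
    using poly_maps_inv [OF poly_maps_antimono [OF c_props(2) that]] .
  have derived_empty: "Q {} = \<one>" if Q: "Q \<in> derived_system c E R" for Q
  proof -
    obtain P \<beta> where P: "P \<in> R" "\<beta> \<in> E"
      and Q_def: "Q = (\<lambda>\<alpha>. inv (P \<beta>) \<otimes> P (\<beta> \<union> \<alpha>) \<otimes> inv (c \<alpha>))"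
      using Q by (auto simp: derived_system_def)
    obtain j where "P \<in> poly_maps j B"
      using dom P(1) by (auto simp: dominated_def in_class_def)
    then have "P \<beta> \<in> carrier G"
      using poly_maps_closed E [OF P(2)] by blast
    then show ?thesis by (simp add: Q_def c_props(3))
  qed
  have ok': "classes_ok B' (M1 + M2)"
    unfolding classes_ok_def
  proof
    fix k assume "k \<in># M1 + M2"
    then consider j c' where "(j, c') \<in># M - {#(i, c)#}" "k = (j, \<lambda>\<alpha>. c' \<alpha> \<otimes> inv (c \<alpha>))"
      | Q where "Q \<in> R'" "k = (Suc i, Q)"
      using fin_R' by (auto simp: M1_def M2_def)
    then show "case k of (j, c') \<Rightarrow> j < N \<and> c' \<in> poly_maps j B' \<and> c' {} = \<one>"
    proof cases
      case 1
      then have jc: "(j, c') \<in># M" by (meson in_diffD)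
      then have "j < N" "c' \<in> poly_maps j B'" "c' {} = \<one>"
        using ok poly_maps_mono [OF _ B'] by (auto simp: classes_ok_def)
      then show ?thesis
        using 1 c_props(3) poly_maps_mult [OF _ c_inv [OF max [OF jc]]] by simp
    next
      case 2
      then show ?thesis using derived_empty by (simp add: R'_def)
    qed
  qed
  have less: "weight (M1 + M2) < weight M"
  proof -
    have "weight M1 = weight (M - {#(i, c)#})"
      by (auto simp: weight_def M1_def multiset.map_comp intro!: image_mset_cong)
    moreover have "\<forall>n. n \<in># weight M2 \<longrightarrow> n < N - i"
      using c_props(1) fin_R' by (auto simp: weight_def M2_def)
    then have "weight M2 < {#N - i#}"
      by (intro ex_gt_imp_less_multiset exI [of _ "N - i"]) simp
    moreover have "weight (add_mset (i, c) K) = weight K + {#N - i#}" for K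
      by (simp add: weight_def)
    from this [of "M - {#(i, c)#}"] have "weight M = weight (M - {#(i, c)#}) + {#N - i#}"
      using c by simp
    ultimately show ?thesis
      by (simp add: weight_def)
  qed
  have "dominated B' (M1 + M2) {Q \<in> derived_system c E R. Q \<notin> poly_maps N B'}"
    unfolding dominated_def
  proof
    fix Q assume "Q \<in> {Q \<in> derived_system c E R. Q \<notin> poly_maps N B'}"
    then have Q: "Q \<in> derived_system c E R" "Q \<notin> poly_maps N B'" by auto
    then obtain P \<beta> where P: "P \<in> R" "\<beta> \<in> E"
      and Q_def: "Q = (\<lambda>\<alpha>. inv (P \<beta>) \<otimes> P (\<beta> \<union> \<alpha>) \<otimes> inv (c \<alpha>))"
      by (auto simp: derived_system_def)
    have \<beta>: "finite \<beta>" "\<beta> \<inter> B = {}" "B \<union> \<beta> \<subseteq> B'"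
      using E [OF P(2)] P(2) by (auto simp: B'_def)
    obtain j c' where jc: "(j, c') \<in># M" and P_j: "P \<in> poly_maps j B"
        "(\<lambda>\<alpha>. P \<alpha> \<otimes> inv (c' \<alpha>)) \<in> poly_maps (Suc j) B" and P0: "P {} = \<one>"
      using dom P(1) by (auto simp: dominated_def in_class_def)
    have P_j': "P \<in> poly_maps j B'" "(\<lambda>\<alpha>. P \<alpha> \<otimes> inv (c' \<alpha>)) \<in> poly_maps (Suc j) B'"
      using P_j poly_maps_mono [OF _ B'] by blast+
    have c': "c' \<in> poly_maps j B'"
      using ok jc poly_maps_mono [OF _ B'] by (auto simp: classes_ok_def)
    define \<Delta> where "\<Delta> = (\<lambda>\<alpha>. inv (P \<beta>) \<otimes> P (\<beta> \<union> \<alpha>) \<otimes> inv (P \<alpha>))"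
    have \<Delta>: "\<Delta> \<in> poly_maps (Suc j) B'"
      unfolding \<Delta>_def using poly_maps_mono [OF poly_maps_difference [OF P_j(1) P0 \<beta>(1,2)] \<beta>(3)] .
    have closed: "P \<beta> \<in> carrier G" "P (\<beta> \<union> \<alpha>) \<in> carrier G" "P \<alpha> \<in> carrier G" "c \<alpha> \<in> carrier G"
      "c' \<alpha> \<in> carrier G" if "finite \<alpha>" for \<alpha>
      using that \<beta>(1) poly_maps_closed [OF P_j(1)] poly_maps_closed [OF c_props(2)]
        poly_maps_closed [OF c'] by auto
    have Q_eq: "Q \<alpha> = \<Delta> \<alpha> \<otimes> (P \<alpha> \<otimes> inv (c \<alpha>))" if "finite \<alpha>" for \<alpha>
      using closed [OF that] by (simp add: Q_def \<Delta>_def group_normalize)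
    have Q_j: "Q \<in> poly_maps j B'"
    proof (rule poly_maps_cong)
      show "(\<lambda>\<alpha>. \<Delta> \<alpha> \<otimes> (P \<alpha> \<otimes> inv (c \<alpha>))) \<in> poly_maps j B'"
        by (rule poly_maps_mult [OF poly_maps_antimono [OF \<Delta>]
            poly_maps_mult [OF P_j'(1) c_inv [OF max [OF jc]]]]) simp
    qed (rule Q_eq)
    have "\<exists>k\<in>#M1 + M2. in_class B' k Q"
    proof (cases "(j, c') = (i, c)")
      case True
      have Q_i: "Q \<in> poly_maps (Suc i) B'"
      proof (rule poly_maps_cong)
        show "(\<lambda>\<alpha>. \<Delta> \<alpha> \<otimes> (P \<alpha> \<otimes> inv (c \<alpha>))) \<in> poly_maps (Suc i) B'"
          using True poly_maps_mult [OF \<Delta> P_j'(2)] by simp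
      qed (rule Q_eq)
      with Q(2) c_props(1) have "Suc i < N"
        by (metis Suc_lessI)
      then have "(Suc i, Q) \<in># M2"
        using Q(1) Q_i fin_R' by (simp add: M2_def R'_def)
      moreover have "in_class B' (Suc i, Q) Q"
        unfolding in_class_def
        using Q_i poly_maps_closed [OF Q_i] poly_maps_cong [OF poly_maps_one [of "Suc (Suc i)" B']]
        by simp
      ultimately show ?thesis by auto
    next
      case False
      obtain K where "M = add_mset (i, c) K" using mset_add [OF c] .
      with False jc have "(j, c') \<in># M - {#(i, c)#}" by auto
      then have "(j, \<lambda>\<alpha>. c' \<alpha> \<otimes> inv (c \<alpha>)) \<in># M1"
        by (force simp: M1_def)
      moreover have "(\<lambda>\<alpha>. Q \<alpha> \<otimes> inv (c' \<alpha> \<otimes> inv (c \<alpha>))) \<in> poly_maps (Suc j) B'"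
      proof (rule poly_maps_cong [OF poly_maps_mult [OF \<Delta> P_j'(2)]])
        fix \<alpha> :: "nat set" assume \<alpha>: "finite \<alpha>"
        then show "Q \<alpha> \<otimes> inv (c' \<alpha> \<otimes> inv (c \<alpha>)) = \<Delta> \<alpha> \<otimes> (P \<alpha> \<otimes> inv (c' \<alpha>))"
          using closed [OF \<alpha>] poly_maps_closed [OF \<Delta> \<alpha>] Q_eq [OF \<alpha>] by (simp add: group_normalize)
      qed
      ultimately show ?thesis
        using Q_j by (auto simp: in_class_def intro!: bexI)
    qed
    then show "Q {} = \<one> \<and> (\<exists>k\<in>#M1 + M2. in_class B' k Q)"
      using derived_empty [OF Q(1)] by simp
  qed
  moreover have "finite B'" using fin E by (auto simp: B'_def)
  ultimately show ?thesis
    using that [of B' "M1 + M2"] ok' less derived_empty by blast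
qed

end

subsection \<open>Colour focusing\<close>

context polynomial_recurrence
begin

text \<open>A stage of the colour focusing argument: \<open>V\<close> has colour \<open>h\<close>, and each colour \<open>g\<close> in \<open>S\<close> is
  the colour of an earlier set into which all of \<open>R\<close> moves \<open>V\<close> at the time \<open>b g\<close>.\<close>

definition focused where
  "focused R D U F S b h V \<longleftrightarrow> S \<subseteq> F \<and> h \<in> F - S \<and> meets V \<and> V \<subseteq> left_quotient G h U
    \<and> (\<forall>g\<in>S. b g \<in> recurrent_part v D \<and> (\<forall>P\<in>R. \<forall>y\<in>V. P (b g) \<otimes> y \<in> left_quotient G g U))"

text \<open>Let \<open>\<alpha>\<close> be a return time for the derived system, and pull the
  returning points of \<open>V\<close> back by \<open>c \<alpha>\<close> to get \<open>W\<close>.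
  Taking \<open>\<beta> = b g\<close> shows that \<open>R\<close> moves \<open>W\<close> into colour
  \<open>g\<close> at time \<open>b g \<union> \<alpha>\<close>; taking \<open>\<beta> = {}\<close>
  shows that at time \<open>\<alpha>\<close> it moves \<open>W\<close> into \<open>V\<close>, which
  has colour \<open>h\<close>. Some part of \<open>W\<close> has a colour \<open>h'\<close>, and
  \<open>avoid\<close> makes it new.\<close>

lemma focused_step:
  assumes st: "focused R D U F S b h V" and F: "finite F" "F \<subseteq> carrier G"
    and c: "\<And>\<alpha>. finite \<alpha> \<Longrightarrow> c \<alpha> \<in> carrier G"
    and R: "\<And>P \<alpha>. P \<in> R \<Longrightarrow> finite \<alpha> \<Longrightarrow> P \<alpha> \<in> carrier G" "\<And>P. P \<in> R \<Longrightarrow> P {} = \<one>"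
    and D: "D \<in> v"
    and ret: "{\<alpha> \<in> finsets. meets (return_set (derived_system c (insert {} (b ` S)) R) V \<alpha>)} \<in> v"
    and cover: "\<And>V. meets V \<Longrightarrow> \<exists>x\<in>F. meets (V \<inter> left_quotient G x U)"
    and avoid: "\<And>\<beta> x W. \<beta> \<in> D \<Longrightarrow> x \<in> F \<Longrightarrow> meets W \<Longrightarrow> W \<subseteq> left_quotient G x U \<Longrightarrow>
      \<exists>P\<in>R. \<exists>y\<in>W. P \<beta> \<otimes> y \<notin> left_quotient G x U"
  shows "\<exists>b' h' V'. focused R D U F (insert h S) b' h' V'"
proof -
  have S: "S \<subseteq> F" "h \<in> F - S" "meets V" "V \<subseteq> left_quotient G h U"
    and b: "\<And>g. g \<in> S \<Longrightarrow> b g \<in> recurrent_part v D"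
      "\<And>g P y. g \<in> S \<Longrightarrow> P \<in> R \<Longrightarrow> y \<in> V \<Longrightarrow> P (b g) \<otimes> y \<in> left_quotient G g U"
    using st by (auto simp: focused_def)
  have D_fin: "finite \<beta>" if "\<beta> \<in> recurrent_part v D" for \<beta>
    using that ultrafiltersD(1) [OF v_ultrafilter D] by (auto simp: recurrent_part_def Fpow_def)
  have fin_S: "finite S" using S(1) F(1) finite_subset by blast
  let ?ret = "{\<alpha> \<in> finsets. meets (return_set (derived_system c (insert {} (b ` S)) R) V \<alpha>)}"
  \<comment> \<open>Only finitely many members of \<open>v\<close> are involved, so a single
    \<open>\<alpha>\<close> is a return time, lies in the recurrent part of \<open>D\<close>, and
    keeps all unions \<open>b g \<union> \<alpha>\<close> there.\<close>
  have "finsets \<inter> (\<Inter>g\<in>S. disjoint_shift (recurrent_part v D) (b g)) \<in> v"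
    by (rule ultrafilters_finite_Inter [OF v_ultrafilter fin_S recurrent_part_shift [OF b(1)]])
  from ultrafiltersD(4) [OF v_ultrafilter this
      ultrafiltersD(4) [OF v_ultrafilter ret recurrent_part_mem [OF D]]]
  have "(finsets \<inter> (\<Inter>g\<in>S. disjoint_shift (recurrent_part v D) (b g))) \<inter> (?ret \<inter> recurrent_part v D) \<noteq> {}"
    using ultrafiltersD(3) [OF v_ultrafilter] by metis
  then obtain \<alpha> where \<alpha>: "finite \<alpha>" "\<alpha> \<in> recurrent_part v D"
      "meets (return_set (derived_system c (insert {} (b ` S)) R) V \<alpha>)"
    and \<alpha>_S: "\<And>g. g \<in> S \<Longrightarrow> b g \<union> \<alpha> \<in> recurrent_part v D"
    by (auto simp: disjoint_shift_def Fpow_def)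
  define W where "W = left_quotient G (c \<alpha>) (return_set (derived_system c (insert {} (b ` S)) R) V \<alpha>)"
  have "meets W"
    unfolding W_def using \<alpha>(3) c [OF \<alpha>(1)] by (rule meets_left_quotient)
  then obtain h' where h': "h' \<in> F" "meets (W \<inter> left_quotient G h' U)"
    using cover by blast
  define b' where "b' g = (if g = h then \<alpha> else b g \<union> \<alpha>)" for g
  have W_V: "P (\<beta> \<union> \<alpha>) \<otimes> y = P \<beta> \<otimes> z \<and> z \<in> V"
    if "y \<in> W" "P \<in> R" "\<beta> \<in> insert {} (b ` S)" "z = inv (P \<beta>) \<otimes> P (\<beta> \<union> \<alpha>) \<otimes> y" for y P \<beta> z
  proof -
    have y: "y \<in> carrier G" "c \<alpha> \<otimes> y \<in> return_set (derived_system c (insert {} (b ` S)) R) V \<alpha>"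
      using that(1) by (auto simp: W_def left_quotient_def)
    have "finite \<beta>" using that(3) b(1) D_fin by auto
    then have P: "P \<beta> \<in> carrier G" "P (\<beta> \<union> \<alpha>) \<in> carrier G"
      using R(1) [OF that(2)] \<alpha>(1) by auto
    have "(\<lambda>\<alpha>. inv (P \<beta>) \<otimes> P (\<beta> \<union> \<alpha>) \<otimes> inv (c \<alpha>)) \<in> derived_system c (insert {} (b ` S)) R"
      using that(2,3) by (force simp: derived_system_def)
    then have "inv (P \<beta>) \<otimes> P (\<beta> \<union> \<alpha>) \<otimes> inv (c \<alpha>) \<otimes> (c \<alpha> \<otimes> y) \<in> V"
      using y(2) by (auto simp: return_set_def)
    then show ?thesis
      using that(4) y(1) P c [OF \<alpha>(1)] by (simp add: group_normalize)
  qed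
  have b'_mem: "b' g \<in> recurrent_part v D" if "g \<in> insert h S" for g
    using that \<alpha>(2) \<alpha>_S by (auto simp: b'_def)
  have b'_moves: "P (b' g) \<otimes> y \<in> left_quotient G g U" if "g \<in> insert h S" "P \<in> R" "y \<in> W" for g P y
  proof (cases "g = h")
    case True
    have "y \<in> carrier G" using that(3) by (simp add: W_def left_quotient_def)
    then have "P \<alpha> \<otimes> y \<in> V"
      using W_V [OF that(3,2), of "{}"] R(1) [OF that(2) \<alpha>(1)] R(2) [OF that(2)] by auto
    then show ?thesis
      using True S(4) by (auto simp: b'_def)
  next
    case False
    then have "g \<in> S" using that(1) by simp
    with that(2) W_V [OF that(3,2), of "b g"] b(2) have "P (b g \<union> \<alpha>) \<otimes> y \<in> left_quotient G g U"
      by auto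
    then show ?thesis using False by (simp add: b'_def)
  qed
  \<comment> \<open>With an old colour, \<open>R\<close> would move a set of colour
    \<open>h'\<close> into that same colour at a time in \<open>D\<close>.\<close>
  have "h' \<notin> insert h S"
  proof
    assume h'_old: "h' \<in> insert h S"
    then have "b' h' \<in> D"
      using b'_mem by (simp add: recurrent_part_def)
    from avoid [OF this h' Int_lower2] show False
      using b'_moves [OF h'_old] by blast
  qed
  then have "focused R D U F (insert h S) b' h' (W \<inter> left_quotient G h' U)"
    using S(1,2) h' b'_mem b'_moves by (auto simp: focused_def)
  then show ?thesis by blast
qed

text \<open>Well-founded induction on the weight. If the return times were not in \<open>v\<close>,
  the induction hypothesis for the derived systems would keep colour focusing going until there are
  more colours than translates in the finite cover \<open>F\<close>.\<close>

theorem recurrence: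
  assumes "finite B" "classes_ok B M" "finite R" "\<And>P. P \<in> R \<Longrightarrow> P {} = \<one>"
    and "dominated B M {P \<in> R. P \<notin> poly_maps N B}" and "meets U"
  shows "{\<alpha> \<in> finsets. meets (return_set R U \<alpha>)} \<in> v"
  using assms
proof (induction "weight M" arbitrary: B M R U rule: less_induct)
  case less
  let ?ret = "{\<alpha> \<in> finsets. meets (return_set R U \<alpha>)}"
  define R1 where "R1 = {P \<in> R. P \<notin> poly_maps N B}"
  have U: "U \<subseteq> carrier G" using less.prems(6) by (rule meets_subset)
  have triv: "P \<alpha> = \<one>" if "P \<in> R - R1" "finite \<alpha>" "\<alpha> \<inter> B = {}" for P \<alpha>
    using that poly_maps_trivial by (auto simp: R1_def)
  have ret_R1: "return_set R1 U \<alpha> \<subseteq> return_set R U \<alpha>" if "finite \<alpha>" "\<alpha> \<inter> B = {}" for \<alpha>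
    using triv [OF _ that] U by (force simp: return_set_def)
  have ret_sub: "return_set R U \<alpha> \<subseteq> carrier G" for \<alpha>
    using U by (auto simp: return_set_def)
  show ?case
  proof (rule ccontr)
    assume contra: "?ret \<notin> v"
    \<comment> \<open>The bad times, taken disjoint from \<open>B\<close> so that the maps of level
      \<open>N\<close> are trivial there and only \<open>R1\<close> can obstruct the return.\<close>
    define D where "D = (finsets - ?ret) \<inter> {\<alpha> \<in> finsets. \<alpha> \<inter> B = {}}"
    have D: "D \<in> v"
      unfolding D_def using contra less.prems(1)
      by (intro ultrafiltersD(4) [OF v_ultrafilter] ultrafiltersD(6) [OF v_ultrafilter] v_avoids) auto
    have D_R1: "\<not> meets (return_set R1 U \<alpha>)" if "\<alpha> \<in> D" for \<alpha>
      using that meets_mono [OF _ ret_R1 ret_sub] by (auto simp: D_def Fpow_def)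
    have R1: "finite R1" "dominated B M R1"
      using less.prems(3,5) by (simp_all add: R1_def)
    have "D \<noteq> {}" using D ultrafiltersD(3) [OF v_ultrafilter] by blast
    have "M \<noteq> {#}"
    proof
      assume "M = {#}"
      then have "R1 = {}" using R1(2) by (auto simp: dominated_def)
      then show False using D_R1 \<open>D \<noteq> {}\<close> less.prems(6) by (auto simp: return_set_def)
    qed
    define i where "i = Max (fst ` set_mset M)"
    have "i \<in> fst ` set_mset M"
      unfolding i_def using \<open>M \<noteq> {#}\<close> by (intro Max_in) auto
    then obtain c where c: "(i, c) \<in># M" by auto
    have max: "j \<le> i" if "(j, c') \<in># M" for j c'
      unfolding i_def using that by (intro Max_ge) (auto simp: rev_image_eqI)
    have c_closed: "c \<alpha> \<in> carrier G" if "finite \<alpha>" for \<alpha>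
      using less.prems(2) c poly_maps_closed that by (auto simp: classes_ok_def)
    obtain F where F: "finite F" "F \<subseteq> carrier G"
      and cover: "\<And>V. meets V \<Longrightarrow> \<exists>x\<in>F. meets (V \<inter> left_quotient G x U)"
      using meets_cover [OF less.prems(6)] by metis
    \<comment> \<open>A point \<open>y\<close> of colour \<open>x\<close> corresponds to the point
      \<open>x \<otimes> y\<close> of \<open>U\<close>, on which \<open>P\<close> acts as its
      conjugate by \<open>x\<close> acts on \<open>y\<close>. So returning to colour
      \<open>x\<close> under \<open>R2\<close> yields a return to \<open>U\<close> under
      \<open>R1\<close>.\<close>
    define R2 where "R2 = {\<lambda>\<alpha>. inv x \<otimes> P \<alpha> \<otimes> x | x P. x \<in> F \<and> P \<in> R1}"
    have R2: "finite R2" "dominated B M R2"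
      using F R1 dominated_conj [OF less.prems(2) R1(2) F(2)]
      by (auto simp: R2_def intro: finite_image_set2)
    have R_closed: "P \<alpha> \<in> carrier G" if "P \<in> R2 \<union> R1" "finite \<alpha>" for P \<alpha>
      using that R2(2) R1(2) poly_maps_closed by (auto simp: dominated_def in_class_def)
    have avoid: "\<exists>P\<in>R2. \<exists>y\<in>W. P \<beta> \<otimes> y \<notin> left_quotient G x U"
      if \<beta>: "\<beta> \<in> D" and x: "x \<in> F" and W: "meets W" "W \<subseteq> left_quotient G x U" for \<beta> x W
    proof (rule ccontr)
      assume "\<not> (\<exists>P\<in>R2. \<exists>y\<in>W. P \<beta> \<otimes> y \<notin> left_quotient G x U)"
      then have *: "P \<beta> \<otimes> y \<in> left_quotient G x U" if "P \<in> R2" "y \<in> W" for P y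
        using that by blast
      have x': "x \<in> carrier G" using x F by blast
      have fin: "finite \<beta>" using \<beta> by (simp add: D_def Fpow_def)
      have "left_quotient G (inv x) W \<subseteq> return_set R1 U \<beta>"
      proof
        fix z assume "z \<in> left_quotient G (inv x) W"
        then have z: "z \<in> carrier G" "inv x \<otimes> z \<in> W" by (auto simp: left_quotient_def)
        have "z \<in> U"
          using z W(2) x' by (auto simp: left_quotient_def mult_inv_cancel_left)
        moreover have "P \<beta> \<otimes> z \<in> U" if P: "P \<in> R1" for P
        proof -
          have "(\<lambda>\<alpha>. inv x \<otimes> P \<alpha> \<otimes> x) \<in> R2"
            using x P by (auto simp: R2_def)
          from * [OF this z(2)] show ?thesis
            using x' z(1) R_closed [OF UnI2 [OF P] fin] by (simp add: left_quotient_def group_normalize)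
        qed
        ultimately show "z \<in> return_set R1 U \<beta>"
          by (simp add: return_set_def)
      qed
      moreover have "return_set R1 U \<beta> \<subseteq> carrier G"
        using U by (auto simp: return_set_def)
      ultimately have "meets (return_set R1 U \<beta>)"
        by (rule meets_mono [OF meets_left_quotient [OF W(1) inv_closed [OF x']]])
      then show False using D_R1 [OF \<beta>] by simp
    qed
    have D_rec: "finite \<beta> \<and> \<beta> \<inter> B = {}" if "\<beta> \<in> recurrent_part v D" for \<beta>
      using that by (auto simp: recurrent_part_def D_def Fpow_def)
    have step: "\<exists>b' h' V'. focused R2 D U F (insert h S) b' h' V'" if st: "focused R2 D U F S b h V" for S b h V
    proof (rule focused_step [OF st F c_closed _ _ D _ cover avoid])
      show "P \<alpha> \<in> carrier G" if "P \<in> R2" "finite \<alpha>" for P \<alpha>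
        using R_closed that by blast
      show "P {} = \<one>" if "P \<in> R2" for P
        using R2(2) that by (simp add: dominated_def)
      have S: "S \<subseteq> F" "meets V" "\<And>g. g \<in> S \<Longrightarrow> b g \<in> recurrent_part v D"
        using st by (auto simp: focused_def)
      have E: "finite (insert {} (b ` S))"
        using S(1) F(1) finite_subset by auto
      have E': "finite \<beta> \<and> \<beta> \<inter> B = {}" if "\<beta> \<in> insert {} (b ` S)" for \<beta>
        using that D_rec S(3) by auto
      obtain B' M' where *: "finite B'" "classes_ok B' M'" "weight M' < weight M"
          "dominated B' M' {Q \<in> derived_system c (insert {} (b ` S)) R2. Q \<notin> poly_maps N B'}"
          "\<forall>Q\<in>derived_system c (insert {} (b ` S)) R2. Q {} = \<one>"
        using derived_system_dominated [OF less.prems(2) R2(2) less.prems(1) R2(1) E E' c max] .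
      have fin: "finite (derived_system c (insert {} (b ` S)) R2)"
        unfolding derived_system_def using E R2(1) by (intro finite_imageI finite_cartesian_product)
      show "{\<alpha> \<in> finsets. meets (return_set (derived_system c (insert {} (b ` S)) R2) V \<alpha>)} \<in> v"
        using *(5) by (intro less.hyps [OF *(3,1,2) fin _ *(4) S(2)]) blast
    qed
    have "\<exists>S b h V. focused R2 D U F S b h V \<and> card S = n" for n
    proof (induction n)
      case 0
      obtain h where "h \<in> F" "meets (U \<inter> left_quotient G h U)"
        using cover [OF less.prems(6)] by blast
      \<comment> \<open>There are no earlier colours yet, so the times are dummies.\<close>
      then have "focused R2 D U F {} (\<lambda>_. {}) h (U \<inter> left_quotient G h U)"
        by (simp add: focused_def)
      then show ?case by (intro exI conjI) auto
    next
      case (Suc n)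
      then obtain S b h V where st: "focused R2 D U F S b h V" "card S = n" by blast
      then have "finite S" "h \<notin> S"
        using F(1) finite_subset by (auto simp: focused_def)
      then have "card (insert h S) = Suc n" using st(2) by simp
      then show ?case using step [OF st(1)] by blast
    qed
    from this [of "Suc (card F)"] obtain S b h V
      where "focused R2 D U F S b h V" "card S = Suc (card F)" by blast
    then show False using card_mono [OF F(1), of S] by (simp add: focused_def)
  qed
qed

end

section \<open>From polynomial mappings to recurrence along a filtration\<close>

theorem theorem2p7:
  fixes G :: "('a, 'b) monoid_scheme"
    and R :: "(nat set \<Rightarrow> 'a) set"
    and v :: "nat set set set"
    and A :: "'a set"
    and L :: "'a set set set"
  assumes "nilpotent_group G"
    and "finite R"
    and "\<And>P. P \<in> R \<Longrightarrow> polynomial_mapping G P"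
    and "\<And>P. P \<in> R \<Longrightarrow> P {} = \<one>\<^bsub>G\<^esub>"
    and "v \<in> adequate_ultrafilters"
    and "v = uplus v v"
    and "piecewise_syndetic G A"
    and "minimal_left_ideal G L"
    and "beta_closure G A \<inter> L \<noteq> {}"
  shows "{\<alpha> \<in> finsets.
           beta_closure G A \<inter> L
             \<inter> (\<Inter>P\<in>R. beta_closure G (left_quotient G (P \<alpha>) A)) \<noteq> {}} \<in> v"
proof -
  interpret nilpotent_group G by fact
  have "\<exists>Qs. (\<forall>Q\<in>set Qs. monomial_mapping G Q)
      \<and> (\<forall>\<alpha>\<in>finsets. P \<alpha> = list_product G (map (\<lambda>Q. Q \<alpha>) Qs))" if "P \<in> R" for P
    using assms(3) [OF that] by (simp add: polynomial_mapping_def)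
  then obtain Qs where Qs: "\<And>P Q. P \<in> R \<Longrightarrow> Q \<in> set (Qs P) \<Longrightarrow> monomial_mapping G Q"
      "\<And>P \<alpha>. P \<in> R \<Longrightarrow> \<alpha> \<in> finsets \<Longrightarrow> P \<alpha> = list_product G (map (\<lambda>Q. Q \<alpha>) (Qs P))"
    by metis
  define \<M> where "\<M> = (\<Union>P\<in>R. set (Qs P))"
  have \<M>: "finite \<M>" "\<And>Q. Q \<in> \<M> \<Longrightarrow> monomial_mapping G Q"
    using assms(2) Qs(1) by (auto simp: \<M>_def)
  from \<M>(2) obtain d u r where mono: "\<And>Q. Q \<in> \<M> \<Longrightarrow> u Q \<in> tuples UNIV (d Q) \<rightarrow> carrier G"
      "\<And>Q. Q \<in> \<M> \<Longrightarrow> linear_order_on (tuples UNIV (d Q)) (r Q)"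
      "\<And>Q \<alpha>. Q \<in> \<M> \<Longrightarrow> \<alpha> \<in> finsets \<Longrightarrow> Q \<alpha> = ordered_product G (r Q) (u Q) (tuples \<alpha> (d Q))"
    unfolding monomial_mapping_def by metis
  \<comment> \<open>The sum bounds every degree that occurs; \<open>Suc\<close> makes the bound
    positive, as \<open>ex_group_filtration\<close> demands.\<close>
  define D where "D = Suc (\<Sum>Q\<in>\<M>. d Q)"
  have d_le: "d Q \<le> D" if "Q \<in> \<M>" for Q
    using member_le_sum [OF that, of d] \<M>(1) by (simp add: D_def)
  obtain \<Gamma> N where filtration: "group_filtration G \<Gamma> N"
    and \<Gamma>: "\<And>j. j \<le> D \<Longrightarrow> \<Gamma> j = carrier G"
    using ex_group_filtration [of D] by (auto simp: D_def)
  interpret group_filtration G \<Gamma> N by fact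
  interpret polynomial_recurrence G \<Gamma> N L v
    using assms(5,6,8) by unfold_locales
  have poly: "P \<in> poly_maps 0 {}" if P: "P \<in> R" for P
  proof (rule poly_maps_cong)
    show "(\<lambda>\<alpha>. list_product G (map (\<lambda>Q. Q \<alpha>) (Qs P))) \<in> poly_maps 0 {}"
    proof (rule poly_maps_list_product)
      fix Q assume "Q \<in> set (Qs P)"
      then have Q: "Q \<in> \<M>" using P by (auto simp: \<M>_def)
      show "Q \<in> poly_maps 0 {}"
        using mono [OF Q] \<Gamma> [OF d_le [OF Q]] by (intro monomial_poly_map)
    qed
    show "P \<alpha> = list_product G (map (\<lambda>Q. Q \<alpha>) (Qs P))" if "finite \<alpha>" for \<alpha>
      using Qs(2) [OF P] that by (simp add: Fpow_def)
  qed
  define R1 where "R1 = {P \<in> R. P \<notin> poly_maps N {}}"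
  \<comment> \<open>At the start every map represents its own class at level 0. For
    \<open>N = 0\<close> no level is admissible, but then \<open>R1\<close> is empty because all of
    \<open>R\<close> has level \<open>N\<close>.\<close>
  define M where "M = (if N = 0 then {#} else image_mset (Pair (0::nat)) (mset_set R1))"
  have fin: "finite R1" using assms(2) by (simp add: R1_def)
  have "classes_ok {} M"
    using fin assms(4) poly by (auto simp: classes_ok_def M_def R1_def)
  moreover have "dominated {} M R1"
    unfolding dominated_def
  proof
    fix P assume P: "P \<in> R1"
    then have P': "P \<in> poly_maps 0 {}" "P {} = \<one>\<^bsub>G\<^esub>" "N \<noteq> 0"
      using poly [of P] assms(4) by (auto simp: R1_def intro!: gr0I)
    have "(\<lambda>\<alpha>. P \<alpha> \<otimes>\<^bsub>G\<^esub> inv\<^bsub>G\<^esub> (P \<alpha>)) \<in> poly_maps (Suc 0) {}"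
      by (rule poly_maps_cong [OF poly_maps_one]) (simp add: poly_maps_closed [OF P'(1)])
    then have "in_class {} (0, P) P"
      using P'(1) by (simp add: in_class_def)
    then show "P {} = \<one>\<^bsub>G\<^esub> \<and> (\<exists>k\<in>#M. in_class {} k P)"
      using P P' fin by (auto simp: M_def)
  qed
  moreover have "meets A"
    using assms(9) by (auto simp: meets_def beta_closure_def)
  ultimately have rec: "{\<alpha> \<in> finsets. meets (return_set R A \<alpha>)} \<in> v"
    using assms(2,4) by (intro recurrence [of "{}" M]) (simp_all add: R1_def)
  show ?thesis
  proof (rule ultrafiltersD(5) [OF v_ultrafilter rec])
    show "{\<alpha> \<in> finsets. meets (return_set R A \<alpha>)} \<subseteq> {\<alpha> \<in> finsets.
           beta_closure G A \<inter> L
             \<inter> (\<Inter>P\<in>R. beta_closure G (left_quotient G (P \<alpha>) A)) \<noteq> {}}"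
    proof clarify
      fix \<alpha> assume "\<alpha> \<in> finsets" "meets (return_set R A \<alpha>)"
        and empty: "beta_closure G A \<inter> L \<inter> (\<Inter>P\<in>R. beta_closure G (left_quotient G (P \<alpha>) A)) = {}"
      then obtain p where p: "p \<in> L" "return_set R A \<alpha> \<in> p"
        by (auto simp: meets_def)
      have p_ultra: "p \<in> ultrafilters (carrier G)" using L_ultrafilter p(1) .
      have A: "A \<subseteq> carrier G" using \<open>meets A\<close> by (rule meets_subset)
      have "A \<in> p"
        using A by (intro ultrafiltersD(5) [OF p_ultra p(2)]) (auto simp: return_set_def)
      moreover have "left_quotient G (P \<alpha>) A \<in> p" if "P \<in> R" for P
        using A that left_quotient_subset
        by (intro ultrafiltersD(5) [OF p_ultra p(2)]) (auto simp: return_set_def left_quotient_def)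
      ultimately have "p \<in> beta_closure G A \<inter> L \<inter> (\<Inter>P\<in>R. beta_closure G (left_quotient G (P \<alpha>) A))"
        using p(1) p_ultra by (auto simp: beta_closure_def)
      then show False using empty by blast
    qed
  qed auto
qed

end
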